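(* Consider the Gaussian sequence model $Y\sim P_{\theta^*}=N(\theta^*,I_p)$ with $\theta^*\in\Theta_{S^*}$, $S^*\subset[p]$, and the empirical Bayes procedure $\Pi_{\widehat\lambda}(\cdot|Y)$ defined with a Laplace slab for some constant $\tau>0$ and weight function $w(\lambda)=\lambda^{\alpha-1}(1-\lambda)^{\beta-1}$ that satisfies $p^{C_1'}\geq\beta/\alpha\geq p^{C_2'}$ for some sufficiently large constants $C_1'>C_2'>0$. Then the following three conditions are satisfied for some constants $C,C_1,C_2,C_3,C_4,C_5>0$ with $C>2C_5$, some constant $\rho>1$ and some $\lambda^*\in[0,1]$. (1) There exists a testing function $\phi$ such that $P_{\theta^*}\phi\leq\exp(-C_1|S^*|\log p)$ and, for any $\epsilon^2\geq|S^*|\log p$ and any $S\subset[p]$, $$\sup_{\theta\in\Theta_S:\|\theta-\theta^*\|^2\geq\epsilon^2}P_\theta(1-\phi)\leq\exp\left(-C\epsilon^2+C_2(|S|\log p+|S^*|\log p)\right).$$ (2) $\displaystyle\sum_{S\subset[p]}\frac{\gamma(S)}{w(\lambda^* )\nu_{\lambda^*}(S^* )}\exp(2C_2|S|\log p)\leq\exp(C_4|S^*|\log p).$ (3) For any $\epsilon^2\geq|S^*|\log p$ and any $S\subset[p]$, $$\frac{\Gamma_S\left(\{\theta\in\Theta_S:\|\theta-\theta^*\|^2\leq\epsilon^2\}\right)}{\Gamma_{S^*}\left(\{\theta\in\Theta_{S^*}:D_\rho(P_{\theta^*}\|P_\theta)\leq C_3|S^*|\log p\}\right)}\leq\exp\left(C_5\epsilon^2+C_2(|S|\log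 p+|S^*|\log p)\right).$$ As a consequence, $$P_{\theta^*}\Pi_{\widehat{\lambda}}\left(\|\theta-\theta^*\|^2>M|S^*|\log p\,\Big|\,Y\right)\leq4\exp(-C'|S^*|\log p),$$ with some constants $M,C'>0$ uniformly over all $\theta^*\in\Theta_{S^*}$.
   Context: For $S\subset[p]=\{1,\ldots,p\}$, $\Theta_S=\{\theta\in\mathbb{R}^p:\theta_j=0\text{ for all }j\notin S\}$. For $\lambda\in[0,1]$, the spike-and-slab prior on $\mathbb{R}^p$ is $\Pi_\lambda=\bigotimes_{j=1}^p\left((1-\lambda)\delta_0+\lambda G\right)$, where $\delta_0$ is the point mass at $0$ and $G$ (the slab) is the Laplace distribution with density $g(x)=\frac{\tau}{2}e^{-\tau|x|}$. It decomposes as $\Pi_\lambda=\sum_{S\subset[p]}\nu_\lambda(S)\Gamma_S$ with $$\nu_\lambda(S)=(1-\lambda)^{p-|S|}\lambda^{|S|},\qquad\Gamma_S=\left(\bigotimes_{j\in S^c}\delta_0\right)\otimes\left(\bigotimes_{j\in S}G\right).$$ The effective weight is $\gamma(S)=\max_{\lambda\in[0,1]}[w(\lambda)\nu_\lambda(S)]$. With $p(Y|\theta)$ the likelihood of $P_\theta=N(\theta,I_p)$, the posterior is $d\Pi_\lambda(\theta|Y)\propto p(Y|\theta)\,d\Pi_\lambda(\theta)$, and $\widehat{\lambda}=\mathop{\rm argmax}_{\lambda\in[0,1]}\log\left[w(\lambda)\int p(Y|\theta)\,d\Pi_\lambda(\theta)\right]$; the empirical Bayes posterior is $\Pi_{\widehat\lambda}(\cdot|Y)$.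 $Pf$ denotes the expectation of $f(Y)$ under $P$; a testing function is a measurable function of $Y$ with values in $[0,1]$; $D_\rho(P\|Q)=\frac{1}{\rho-1}\log\int\left(\frac{dP}{dQ}\right)^{\rho-1}dP$; $\|\cdot\|$ is the Euclidean norm.
   Formalization: The formal theorem assumes α ≥ 1 (for α < 1 the maximum defining γ(∅) does not exist), states conditions (1)–(3) only for p ≥ 2 (for p = 1, (2) fails), and states condition (2) only for nonempty S* (for S* = ∅ it is false); the posterior bound is kept for all p ≥ 1 and all S*. *)

theory Defs
  imports "HOL-Probability.Probability"
begin

(* A vector of R^p is an element of space (PiM {1..p} (\<lambda>_. borel)), i.e. a function on {1..p}
   that is undefined elsewhere.  This keeps p a term, so that constants can be chosen before p. *)
definition vecs :: "nat \<Rightarrow> (nat \<Rightarrow> real) set" where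
  "vecs p = {1..p} \<rightarrow>\<^sub>E UNIV"

definition sq_dist :: "nat \<Rightarrow> (nat \<Rightarrow> real) \<Rightarrow> (nat \<Rightarrow> real) \<Rightarrow> real" where
  "sq_dist p x y = (L2_set (\<lambda>j. x j - y j) {1..p})\<^sup>2"

definition Theta :: "nat \<Rightarrow> nat set \<Rightarrow> (nat \<Rightarrow> real) set" where
  "Theta p S = {\<theta> \<in> vecs p. \<forall>j\<in>{1..p} - S. \<theta> j = 0}"

definition likelihood :: "nat \<Rightarrow> (nat \<Rightarrow> real) \<Rightarrow> (nat \<Rightarrow> real) \<Rightarrow> real" where
  "likelihood p \<theta> Y = (\<Prod>j\<in>{1..p}. normal_density (\<theta> j) 1 (Y j))"

definition gauss :: "nat \<Rightarrow> (nat \<Rightarrow> real) \<Rightarrow> (nat \<Rightarrow> real) measure" where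
  "gauss p \<theta> = density (PiM {1..p} (\<lambda>_. lborel)) (\<lambda>Y. ennreal (likelihood p \<theta> Y))"

definition laplace :: "real \<Rightarrow> real measure" where
  "laplace \<tau> = density lborel (\<lambda>x. ennreal (\<tau> / 2 * exp (- \<tau> * \<bar>x\<bar>)))"

definition mixture :: "real \<Rightarrow> real \<Rightarrow> real measure" where
  "mixture \<tau> l = measure_of UNIV (sets borel)
     (\<lambda>A. ennreal (1 - l) * emeasure (return borel 0) A + ennreal l * emeasure (laplace \<tau>) A)"

lemma emeasure_mixture:
  assumes "A \<in> sets borel"
  shows "emeasure (mixture \<tau> l) A =
    ennreal (1 - l) * emeasure (return borel 0) A + ennreal l * emeasure (laplace \<tau>) A"
proof (rule emeasure_measure_of[OF mixture_def])
  let ?f = "\<lambda>A. ennreal (1 - l) * emeasure (return borel (0::real)) A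
    + ennreal l * emeasure (laplace \<tau>) A"
  have s: "sets (mixture \<tau> l) = sets borel"
    unfolding mixture_def using sets.sigma_sets_eq[of "borel :: real measure"] by simp
  show "sets borel \<subseteq> Pow (UNIV :: real set)" by simp
  show "positive (sets (mixture \<tau> l)) ?f" by (simp add: positive_def)
  show "countably_additive (sets (mixture \<tau> l)) ?f"
    unfolding s
  proof (rule countably_additiveI)
    fix F :: "nat \<Rightarrow> real set"
    assume F: "range F \<subseteq> sets borel" "disjoint_family F"
    have "(\<Sum>i. emeasure (return borel 0) (F i)) = emeasure (return borel 0) (\<Union>i. F i)"
      by (rule suminf_emeasure) (use F in auto)
    moreover have "(\<Sum>i. emeasure (laplace \<tau>) (F i)) = emeasure (laplace \<tau>) (\<Union>i. F i)"
      by (rule suminf_emeasure) (use F in \<open>auto simp: laplace_def\<close>)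
    ultimately show "(\<Sum>i. ?f (F i)) = ?f (\<Union>i. F i)"
      by (simp only: suminf_add[OF summableI summableI, symmetric] ennreal_suminf_cmult)
  qed
  show "A \<in> sets (mixture \<tau> l)" using assms s by simp
qed

definition spike_slab :: "nat \<Rightarrow> real \<Rightarrow> real \<Rightarrow> (nat \<Rightarrow> real) measure" where
  "spike_slab p \<tau> l = PiM {1..p} (\<lambda>_. mixture \<tau> l)"

definition nu :: "nat \<Rightarrow> real \<Rightarrow> nat set \<Rightarrow> real" where
  "nu p l S = (1 - l) ^ (p - card S) * l ^ card S"

definition Gamma_prior :: "nat \<Rightarrow> real \<Rightarrow> nat set \<Rightarrow> (nat \<Rightarrow> real) measure" where
  "Gamma_prior p \<tau> S = PiM {1..p} (\<lambda>j. if j \<in> S then laplace \<tau> else return borel 0)"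

(* powr has 0 powr 0 = 0; the weight needs 0^0 = 1 (e.g. at \<lambda> = 0 when \<alpha> = 1). *)
definition pow0 :: "real \<Rightarrow> real \<Rightarrow> real" where
  "pow0 x a = (if a = 0 then 1 else x powr a)"

definition beta_weight :: "real \<Rightarrow> real \<Rightarrow> real \<Rightarrow> real" where
  "beta_weight \<alpha> \<beta> l = pow0 l (\<alpha> - 1) * pow0 (1 - l) (\<beta> - 1)"

(* The maximum over [0,1], written as a supremum; it is attained by eff_weight_attained below. *)
definition eff_weight :: "nat \<Rightarrow> (real \<Rightarrow> real) \<Rightarrow> nat set \<Rightarrow> real" where
  "eff_weight p w S = (SUP l\<in>{0..1}. w l * nu p l S)"

lemma eff_weight_attained:
  assumes "\<alpha> \<ge> 1" "\<beta> \<ge> 1"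
  shows "\<exists>l\<in>{0..1}. eff_weight p (beta_weight \<alpha> \<beta>) S = beta_weight \<alpha> \<beta> l * nu p l S
    \<and> (\<forall>l'\<in>{0..1}. beta_weight \<alpha> \<beta> l' * nu p l' S \<le> beta_weight \<alpha> \<beta> l * nu p l S)"
proof -
  let ?h = "\<lambda>l. beta_weight \<alpha> \<beta> l * nu p l S"
  have *: "continuous_on {0..1} (\<lambda>l. pow0 (f l) (a - 1))"
    if "a \<ge> 1" "continuous_on {0..1} f" "\<And>l. l \<in> {0..1} \<Longrightarrow> f l \<ge> 0"
    for a :: real and f :: "real \<Rightarrow> real"
  proof (cases "a = 1")
    case False
    have "continuous_on {0..1} (\<lambda>l. f l powr (a - 1))"
      by (rule continuous_on_powr') (use that False in auto)
    then show ?thesis using False by (simp add: pow0_def)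
  qed (simp add: pow0_def)
  have 1: "continuous_on {0..1} (\<lambda>l. pow0 l (\<alpha> - 1))"
    by (rule *) (use assms in auto)
  have 2: "continuous_on {0..1} (\<lambda>l. pow0 (1 - l) (\<beta> - 1))"
    by (rule *) (use assms in \<open>auto intro!: continuous_intros\<close>)
  have "continuous_on {0..1} ?h"
    unfolding beta_weight_def nu_def by (intro continuous_intros 1 2)
  then obtain l where l: "l \<in> {0..1}" "\<forall>l'\<in>{0..1}. ?h l' \<le> ?h l"
    using continuous_attains_sup[of "{0..1::real}" ?h] by auto
  then have "eff_weight p (beta_weight \<alpha> \<beta>) S = ?h l"
    unfolding eff_weight_def by (intro cSup_eq_maximum) auto
  with l show ?thesis by blast
qed

definition marginal :: "nat \<Rightarrow> real \<Rightarrow> real \<Rightarrow> (nat \<Rightarrow> real) \<Rightarrow> ennreal" where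
  "marginal p \<tau> l Y = (\<integral>\<^sup>+ \<theta>. ennreal (likelihood p \<theta> Y) \<partial>spike_slab p \<tau> l)"

definition posterior :: "nat \<Rightarrow> real \<Rightarrow> real \<Rightarrow> (nat \<Rightarrow> real) \<Rightarrow> (nat \<Rightarrow> real) measure" where
  "posterior p \<tau> l Y =
     density (spike_slab p \<tau> l) (\<lambda>\<theta>. ennreal (likelihood p \<theta> Y) / marginal p \<tau> l Y)"

(* Extended logarithm; ln on the reals has ln 0 = 0, which would spoil the arg max below. *)
definition ext_ln :: "ennreal \<Rightarrow> ereal" where
  "ext_ln x = (if x = 0 then - \<infinity> else if x = \<infinity> then \<infinity> else ereal (ln (enn2real x)))"

definition lam_hat :: "nat \<Rightarrow> real \<Rightarrow> (real \<Rightarrow> real) \<Rightarrow> (nat \<Rightarrow> real) \<Rightarrow> real" where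
  "lam_hat p \<tau> w Y = arg_max_on (\<lambda>l. ext_ln (ennreal (w l) * marginal p \<tau> l Y)) {0..1}"

definition renyi :: "real \<Rightarrow> 'a measure \<Rightarrow> 'a measure \<Rightarrow> ereal" where
  "renyi \<rho> P Q =
     (if absolutely_continuous Q P
      then ereal (1 / (\<rho> - 1)) *
        ext_ln (\<integral>\<^sup>+ x. ennreal (enn2real (RN_deriv Q P x) powr (\<rho> - 1)) \<partial>P)
      else \<infinity>)"

end

theory Submission
  imports Defs
begin

text \<open>
  All bounds factor over coordinates.  With \<open>r = s\<^sup>* ln p\<close>, the test is \<open>min 1 X\<close> for
  \<open>X = exp (-3 r) \<Prod>\<^sub>j (1 + p\<^sup>-\<^sup>3 exp ((Y\<^sub>j - \<theta>\<^sup>*\<^sub>j)\<^sup>2 / 4))\<close>, a sum over all sets \<open>S\<close> of exponentiated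
  chi-square statistics; its two errors are bounded by the expectations of \<open>X\<close> and of \<open>1 / X\<close>.
  For the prior masses, \<open>\<Gamma>\<^sub>S\<close>-integrals of \<open>exp (- \<parallel>\<theta> - \<theta>\<^sup>*\<parallel>\<^sup>2 / 16)\<close> and
  \<open>\<Gamma>\<close>-measures of balls around \<open>\<theta>\<^sup>*\<close> share the factor \<open>exp (- \<tau> \<parallel>\<theta>\<^sup>*\<parallel>\<^sub>1)\<close>, which cancels in
  the ratio, so no bound on \<open>\<theta>\<^sup>*\<close> is required.  The effective weights are maxima of beta kernels
  and are compared by \<open>ln x \<le> x - 1\<close>.  For the posterior, maximality of the estimated weight bounds
  the denominator below by its value at a fixed \<open>\<lambda>\<^sup>*\<close>, and the prior decomposition bounds the
  numerator by a sum over \<open>S\<close> of effective weights times \<open>\<Gamma>\<^sub>S\<close>-integrals.  The remaining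
  expectation is computed by Fubini, keeping \<open>exp (- 5 \<parallel>\<theta> - \<theta>\<^sup>*\<parallel>\<^sup>2 / 48)\<close> of the error bound
  \<open>exp (- \<parallel>\<theta> - \<theta>\<^sup>*\<parallel>\<^sup>2 / 6)\<close> to beat the constants.
\<close>

subsection \<open>Decomposition of the spike-and-slab prior\<close>

text \<open>The numerical constants share one budget. The coefficient 1/4 in the test is below the
  1/2 of the Gaussian exponent, so its null mean is finite, and it yields the rate
  \<open>C = 1/6\<close>. The bump coefficient 1/16 becomes \<open>C5\<close>; it satisfies 1/6 >
  2/16, and 1/6 - 1/16 = 5/48 is what beats the constants once \<open>M\<close> is large. The order
  \<open>\<rho> = 2\<close> makes the divergence exactly the squared distance, so the ball in
  condition (3) is Euclidean. Costs have to grow with the sizes of \<open>S\<close> and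
  \<open>S\<^sup>*\<close> and not with p, which forces a bound of at most 1 at coordinates where
  spike and truth are both 0. The delicate choice is \<open>\<lambda>\<^sup>*\<close>: for
  \<open>\<alpha> = 1\<close> the kernel of the empty set peaks at 0, where every nonempty set has
  weight 0. A shifted point is used, at the price of a factor e. Such absolute factors are absorbed
  because r is at least 1/2 when p is at least 2 and \<open>S\<^sup>*\<close> is nonempty; in the
  remaining cases r = 0 and the contraction bound is 4.\<close>

lemma nn_integral_PiM_mixture:
  fixes M N0 N1 :: "'a measure" and c0 c1 :: ennreal and f :: "('i \<Rightarrow> 'a) \<Rightarrow> ennreal"
  assumes "finite I" and sf: "sigma_finite_measure M" "sigma_finite_measure N0" "sigma_finite_measure N1"
    and sets[measurable_cong]: "sets N0 = sets M" "sets N1 = sets M"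
    and mix: "\<And>h. h \<in> borel_measurable M \<Longrightarrow>
      (\<integral>\<^sup>+x. h x \<partial>M) = c0 * (\<integral>\<^sup>+x. h x \<partial>N0) + c1 * (\<integral>\<^sup>+x. h x \<partial>N1)"
    and "f \<in> borel_measurable (PiM I (\<lambda>_. M))"
  shows "(\<integral>\<^sup>+x. f x \<partial>PiM I (\<lambda>_. M)) =
    (\<Sum>S\<in>Pow I. c0 ^ (card I - card S) * c1 ^ card S *
      (\<integral>\<^sup>+x. f x \<partial>PiM I (\<lambda>i. if i \<in> S then N1 else N0)))"
  using assms(1) assms(8)
\<comment> \<open>The integrand stays arbitrary because the hypothesis is applied to the sections
  \<open>f (x(j := y))\<close>. Subsets of \<open>insert j I\<close> split into those without
  \<open>j\<close>, which use \<open>N0\<close> there, and those with \<open>j\<close>, which use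
  \<open>N1\<close>.\<close>
proof (induction I arbitrary: f rule: finite_induct)
  case empty
  then show ?case by (simp add: PiM_empty)
next
  case (insert j I)
  note [measurable] = insert.prems
  interpret M: product_sigma_finite "\<lambda>_::'i. M"
    by (simp add: product_sigma_finite_def sf)
  have P: "product_sigma_finite (\<lambda>i::'i. if i \<in> S then N1 else N0)" for S
    by (auto simp: product_sigma_finite_def sf)
  have setsP: "sets (PiM J (\<lambda>i. if i \<in> S then N1 else N0)) = sets (PiM J (\<lambda>_. M))" for J :: "'i set" and S
    by (rule sets_PiM_cong) (auto simp: sets)
  define a where "a S = c0 ^ (card I - card S) * c1 ^ card S" for S :: "'i set"
  define F where "F S y = (\<integral>\<^sup>+x. f (x(j := y)) \<partial>PiM I (\<lambda>i. if i \<in> S then N1 else N0))" for S y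
  have upd: "(\<lambda>(y, x). f (x(j := y))) \<in> borel_measurable (M \<Otimes>\<^sub>M PiM I (\<lambda>_. M))"
    by measurable
  have F[measurable]: "F S \<in> borel_measurable M" for S
  proof -
    interpret p: product_sigma_finite "\<lambda>i::'i. if i \<in> S then N1 else N0" by (rule P)
    interpret sigma_finite_measure "PiM I (\<lambda>i. if i \<in> S then N1 else N0)"
      by (rule p.sigma_finite) fact
    have "(\<lambda>(y, x). f (x(j := y))) \<in> borel_measurable (M \<Otimes>\<^sub>M PiM I (\<lambda>i. if i \<in> S then N1 else N0))"
      using upd by (subst measurable_cong_sets[OF sets_pair_measure_cong[OF refl setsP] refl])
    then show ?thesis unfolding F_def by (rule borel_measurable_nn_integral)
  qed
  \<comment> \<open>On \<open>I\<close> the labelling cannot see \<open>j\<close>, so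
    \<open>S\<close> and \<open>insert j S\<close> share the inner integral
    \<open>F S\<close>.\<close>
  have rev: "(\<integral>\<^sup>+x. f x \<partial>PiM (insert j I) (\<lambda>i. if i \<in> T then N1 else N0)) =
      (\<integral>\<^sup>+y. F (T - {j}) y \<partial>(if j \<in> T then N1 else N0))" for T
  proof -
    interpret p: product_sigma_finite "\<lambda>i::'i. if i \<in> T then N1 else N0" by (rule P)
    have "PiM I (\<lambda>i. if i \<in> T then N1 else N0) = PiM I (\<lambda>i. if i \<in> T - {j} then N1 else N0)"
      using insert.hyps by (intro PiM_cong) auto
    moreover have "f \<in> borel_measurable (PiM (insert j I) (\<lambda>i. if i \<in> T then N1 else N0))"
      using insert.prems by (subst measurable_cong_sets[OF setsP refl])
    ultimately show ?thesis
      unfolding F_def by (subst p.product_nn_integral_insert_rev) (use insert.hyps in auto)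
  qed
  have IH: "(\<integral>\<^sup>+x. f (x(j := y)) \<partial>PiM I (\<lambda>_. M)) = (\<Sum>S\<in>Pow I. a S * F S y)" if "y \<in> space M" for y
    unfolding a_def F_def using that by (intro insert.IH) measurable
  have "(\<integral>\<^sup>+x. f x \<partial>PiM (insert j I) (\<lambda>_. M)) = (\<integral>\<^sup>+y. (\<Sum>S\<in>Pow I. a S * F S y) \<partial>M)"
    using insert.hyps
    by (subst M.product_nn_integral_insert_rev) (auto intro!: nn_integral_cong simp: IH)
  also have "\<dots> = (\<Sum>S\<in>Pow I. a S * (\<integral>\<^sup>+y. F S y \<partial>M))"
    by (simp add: nn_integral_sum nn_integral_cmult)
  also have "\<dots> = (\<Sum>S\<in>Pow I. a S * c0 * (\<integral>\<^sup>+y. F S y \<partial>N0)) + (\<Sum>S\<in>Pow I. a S * c1 * (\<integral>\<^sup>+y. F S y \<partial>N1))"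
    by (simp add: mix distrib_left sum.distrib mult.assoc)
  also have "(\<Sum>S\<in>Pow I. a S * c0 * (\<integral>\<^sup>+y. F S y \<partial>N0)) =
     (\<Sum>S\<in>Pow I. c0 ^ (card (insert j I) - card S) * c1 ^ card S *
      (\<integral>\<^sup>+x. f x \<partial>PiM (insert j I) (\<lambda>i. if i \<in> S then N1 else N0)))"
  proof (rule sum.cong[OF refl])
    fix S assume "S \<in> Pow I"
    then have "j \<notin> S" "card S \<le> card I" using insert.hyps by (auto intro: card_mono)
    then show "a S * c0 * (\<integral>\<^sup>+y. F S y \<partial>N0) = c0 ^ (card (insert j I) - card S) * c1 ^ card S *
      (\<integral>\<^sup>+x. f x \<partial>PiM (insert j I) (\<lambda>i. if i \<in> S then N1 else N0))"
      using insert.hyps by (simp add: rev a_def Suc_diff_le mult_ac)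
  qed
  also have "(\<Sum>S\<in>Pow I. a S * c1 * (\<integral>\<^sup>+y. F S y \<partial>N1)) =
     (\<Sum>S\<in>insert j ` Pow I. c0 ^ (card (insert j I) - card S) * c1 ^ card S *
      (\<integral>\<^sup>+x. f x \<partial>PiM (insert j I) (\<lambda>i. if i \<in> S then N1 else N0)))"
  proof (subst sum.reindex)
    show "inj_on (insert j) (Pow I)" using insert.hyps by (auto simp: inj_on_def)
    show "(\<Sum>S\<in>Pow I. a S * c1 * (\<integral>\<^sup>+y. F S y \<partial>N1)) = sum ((\<lambda>S. c0 ^ (card (insert j I) - card S) * c1 ^ card S *
      (\<integral>\<^sup>+x. f x \<partial>PiM (insert j I) (\<lambda>i. if i \<in> S then N1 else N0))) \<circ> insert j) (Pow I)"
    proof (rule sum.cong[OF refl])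
      fix S assume "S \<in> Pow I"
      then have "j \<notin> S" "finite S" using insert.hyps by (auto intro: finite_subset)
      then show "a S * c1 * (\<integral>\<^sup>+y. F S y \<partial>N1) = ((\<lambda>S. c0 ^ (card (insert j I) - card S) * c1 ^ card S *
        (\<integral>\<^sup>+x. f x \<partial>PiM (insert j I) (\<lambda>i. if i \<in> S then N1 else N0))) \<circ> insert j) S"
        using insert.hyps by (simp add: rev a_def mult_ac)
    qed
  qed
  also have "(\<Sum>S\<in>Pow I. c0 ^ (card (insert j I) - card S) * c1 ^ card S *
      (\<integral>\<^sup>+x. f x \<partial>PiM (insert j I) (\<lambda>i. if i \<in> S then N1 else N0))) + \<dots> =
     (\<Sum>S\<in>Pow (insert j I). c0 ^ (card (insert j I) - card S) * c1 ^ card S *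
      (\<integral>\<^sup>+x. f x \<partial>PiM (insert j I) (\<lambda>i. if i \<in> S then N1 else N0)))"
    unfolding Pow_insert using insert.hyps by (intro sum.union_disjoint[symmetric]) auto
  finally show ?case .
qed

section \<open>Integration against the one-coordinate mixture and slab\<close>

lemma sets_mixture[measurable_cong, simp]: "sets (mixture \<tau> l) = sets borel"
  unfolding mixture_def using sets.sigma_sets_eq[of "borel :: real measure"] by simp

lemma sets_laplace[measurable_cong, simp]: "sets (laplace \<tau>) = sets borel"
  by (simp add: laplace_def)

lemma space_mixture[simp]: "space (mixture \<tau> l) = UNIV"
  by (simp add: mixture_def)

lemma space_laplace[simp]: "space (laplace \<tau>) = UNIV"
  by (simp add: laplace_def)

text \<open>\<open>mixture\<close> is given only through its values on sets, so the identity is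
  lifted from indicators through multiples, sums and monotone limits.\<close>

lemma nn_integral_mixture:
  assumes "h \<in> borel_measurable borel"
  shows "(\<integral>\<^sup>+x. h x \<partial>mixture \<tau> l) =
    ennreal (1 - l) * (\<integral>\<^sup>+x. h x \<partial>return borel 0) + ennreal l * (\<integral>\<^sup>+x. h x \<partial>laplace \<tau>)"
  using assms
proof (induction rule: borel_measurable_induct)
  case (cong f g)
  then show ?case by (simp cong: nn_integral_cong)
next
  case (set A)
  then show ?case by (simp add: emeasure_mixture)
next
  case (mult u c)
  then show ?case
    by (subst (1 2 3) nn_integral_cmult) (auto simp: distrib_left mult.left_commute)
next
  case (add u v)
  then show ?case
    by (subst (1 2 3) nn_integral_add) (auto simp: distrib_left add_ac)
next
  case (seq U)
  have eq: "(\<integral>\<^sup>+x. (SUP i. U i) x \<partial>N) = (SUP i. \<integral>\<^sup>+x. U i x \<partial>N)" if "sets N = sets borel" for N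
  proof -
    have "U i \<in> borel_measurable N" for i
      using seq(1) that by (subst measurable_cong_sets[OF that refl]) simp
    then have "(\<integral>\<^sup>+x. (SUP i. U i x) \<partial>N) = (SUP i. \<integral>\<^sup>+x. U i x \<partial>N)"
      by (rule nn_integral_monotone_convergence_SUP[OF seq(3)])
    then show ?thesis by (simp add: image_comp)
  qed
  have mono: "incseq (\<lambda>i. c * (\<integral>\<^sup>+x. U i x \<partial>N))" for N and c :: ennreal
    using seq(3) by (intro incseq_SucI mult_left_mono nn_integral_mono) (auto simp: incseq_Suc_iff le_fun_def)
  have "(\<integral>\<^sup>+x. (SUP i. U i) x \<partial>mixture \<tau> l) = (SUP i. ennreal (1 - l) * (\<integral>\<^sup>+x. U i x \<partial>return borel 0)
      + ennreal l * (\<integral>\<^sup>+x. U i x \<partial>laplace \<tau>))"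
    by (simp only: eq[OF sets_mixture] seq.IH)
  also have "\<dots> = ennreal (1 - l) * (SUP i. \<integral>\<^sup>+x. U i x \<partial>return borel 0)
      + ennreal l * (SUP i. \<integral>\<^sup>+x. U i x \<partial>laplace \<tau>)"
    by (subst ennreal_SUP_add[OF mono mono]) (simp only: SUP_mult_left_ennreal)
  also have "\<dots> = ennreal (1 - l) * (\<integral>\<^sup>+x. (SUP i. U i) x \<partial>return borel 0)
      + ennreal l * (\<integral>\<^sup>+x. (SUP i. U i) x \<partial>laplace \<tau>)"
    by (simp only: eq[OF sets_return] eq[OF sets_laplace])
  finally show ?case .
qed

text \<open>Away from 0 the density is the average of the exponential density and its mirror image,
  each of mass 1.\<close>

lemma prob_space_laplace:
  assumes "\<tau> > 0"
  shows "prob_space (laplace \<tau>)"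
proof
  define e where "e x = ennreal (exponential_density \<tau> x)" for x
  have [measurable]: "e \<in> borel_measurable borel" by (simp add: e_def[abs_def])
  interpret E: prob_space "density lborel (exponential_density \<tau>)"
    by (rule prob_space_exponential_density) fact
  have 1: "(\<integral>\<^sup>+x. e x \<partial>lborel) = 1"
    using E.emeasure_space_1 by (simp add: emeasure_density e_def)
  then have 2: "(\<integral>\<^sup>+x. e (- x) \<partial>lborel) = 1"
    using nn_integral_real_affine[of e "-1" 0] by simp
  have "(\<integral>\<^sup>+x. ennreal (\<tau> / 2 * exp (- \<tau> * \<bar>x\<bar>)) \<partial>lborel) =
      (\<integral>\<^sup>+x. ennreal (1 / 2) * (e x + e (- x)) \<partial>lborel)"
  \<comment> \<open>At 0 both halves are active and their average is twice too large, hence equality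
    only almost everywhere.\<close>
  proof (rule nn_integral_cong_AE)
    have "AE x in lborel. x \<noteq> (0::real)" by (rule AE_lborel_singleton)
    then show "AE x in lborel. ennreal (\<tau> / 2 * exp (- \<tau> * \<bar>x\<bar>)) = ennreal (1 / 2) * (e x + e (- x))"
    proof eventually_elim
      case (elim x)
      then have "e x + e (- x) = ennreal (\<tau> * exp (- \<tau> * \<bar>x\<bar>))"
        using assms by (auto simp: e_def exponential_density_def abs_if mult_ac)
      then show ?case using assms by (simp only: ennreal_mult'[symmetric]) simp
    qed
  qed
  also have "\<dots> = ennreal (1 / 2) * 2"
    by (simp add: nn_integral_cmult nn_integral_add 1 2)
  also have "\<dots> = 1"
    by (subst ennreal_numeral[symmetric], subst ennreal_mult'[symmetric]) auto
  finally have "(\<integral>\<^sup>+x. ennreal (\<tau> / 2 * exp (- \<tau> * \<bar>x\<bar>)) \<partial>lborel) = 1" .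
  then show "emeasure (laplace \<tau>) (space (laplace \<tau>)) = 1"
    by (simp add: laplace_def emeasure_density)
qed

lemma prob_space_mixture:
  assumes "\<tau> > 0" "l \<in> {0..1}"
  shows "prob_space (mixture \<tau> l)"
proof
  interpret prob_space "laplace \<tau>" by (rule prob_space_laplace) fact
  have "emeasure (laplace \<tau>) UNIV = 1" using emeasure_space_1 by simp
  then show "emeasure (mixture \<tau> l) (space (mixture \<tau> l)) = 1"
    using assms by (simp add: emeasure_mixture flip: ennreal_plus)
qed

lemma prob_space_Gamma_prior:
  assumes "\<tau> > 0"
  shows "prob_space (Gamma_prior p \<tau> S)"
  unfolding Gamma_prior_def
  by (intro prob_space_PiM) (auto intro: prob_space_laplace prob_space_return assms)

lemma sets_Gamma_prior[measurable_cong, simp]: "sets (Gamma_prior p \<tau> S) = sets (PiM {1..p} (\<lambda>_. borel))"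
  unfolding Gamma_prior_def by (rule sets_PiM_cong) auto

lemma sets_spike_slab[measurable_cong, simp]: "sets (spike_slab p \<tau> l) = sets (PiM {1..p} (\<lambda>_. borel))"
  unfolding spike_slab_def by (rule sets_PiM_cong) auto

lemma nn_integral_spike_slab:
  assumes "\<tau> > 0" "l \<in> {0..1}" "f \<in> borel_measurable (PiM {1..p} (\<lambda>_. borel))"
  shows "(\<integral>\<^sup>+\<theta>. f \<theta> \<partial>spike_slab p \<tau> l) =
    (\<Sum>S\<in>Pow {1..p}. ennreal (nu p l S) * (\<integral>\<^sup>+\<theta>. f \<theta> \<partial>Gamma_prior p \<tau> S))"
proof -
  have "(\<integral>\<^sup>+\<theta>. f \<theta> \<partial>spike_slab p \<tau> l) = (\<Sum>S\<in>Pow {1..p}. ennreal (1 - l) ^ (card {1..p} - card S) * ennreal l ^ card S *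
      (\<integral>\<^sup>+x. f x \<partial>PiM {1..p} (\<lambda>i. if i \<in> S then laplace \<tau> else return borel 0)))"
    unfolding spike_slab_def
  proof (rule nn_integral_PiM_mixture)
    show "f \<in> borel_measurable (PiM {1..p} (\<lambda>_. mixture \<tau> l))"
      using assms(3) by (simp cong: measurable_cong_sets sets_PiM_cong)
  qed (auto intro!: nn_integral_mixture prob_space_imp_sigma_finite prob_space_mixture
      prob_space_laplace prob_space_return assms(1,2))
  also have "\<dots> = (\<Sum>S\<in>Pow {1..p}. ennreal (nu p l S) * (\<integral>\<^sup>+\<theta>. f \<theta> \<partial>Gamma_prior p \<tau> S))"
    using assms(2) by (auto intro!: sum.cong simp: nu_def Gamma_prior_def ennreal_power ennreal_mult)
  finally show ?thesis .
qed

subsection \<open>Gaussian integrals\<close>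

declare One_nat_def[simp del]

lemma nn_integral_normal_density:
  assumes "\<sigma> > 0"
  shows "(\<integral>\<^sup>+x. ennreal (normal_density \<mu> \<sigma> x) \<partial>lborel) = 1"
proof -
  interpret prob_space "density lborel (normal_density \<mu> \<sigma>)"
    by (rule prob_space_normal_density) fact
  show ?thesis using emeasure_space_1 by (simp add: emeasure_density)
qed

lemma nn_integral_normal_density_cmult:
  assumes "\<sigma> > 0" "c \<ge> 0"
  shows "(\<integral>\<^sup>+x. ennreal (c * normal_density \<mu> \<sigma> x) \<partial>lborel) = ennreal c"
  using assms by (simp add: ennreal_mult' nn_integral_cmult nn_integral_normal_density)

text \<open>The factor removes half of the Gaussian exponent and leaves variance 2, so
  \<open>exp ((x - t)\<^sup>2 / 4)\<close> has mean \<open>sqrt 2\<close> under the null.\<close>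

lemma exp_quarter_times_normal_density:
  "exp ((x - t)\<^sup>2 / 4) * normal_density t 1 x = sqrt 2 * normal_density t (sqrt 2) x"
proof -
  have "sqrt (2 * pi * 2) = sqrt 2 * sqrt (2 * pi)" by (simp add: real_sqrt_mult)
  then show ?thesis
    by (simp add: normal_density_def exp_add[symmetric] field_simps)
qed

text \<open>Completing the square: the quadratic coefficients \<open>a = 1/4\<close> and \<open>b = 1/2\<close> leave
  \<open>a b / (a + b) = 1/6\<close> on the squared distance of the centres.\<close>

lemma exp_neg_quarter_times_normal_density:
  "exp (- (x - t)\<^sup>2 / 4) * normal_density u 1 x =
    sqrt (2/3) * exp (- (u - t)\<^sup>2 / 6) * normal_density ((t + 2 * u) / 3) (sqrt (2/3)) x"
proof -
  define q :: real where "q = sqrt (2/3)"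
  have q: "q > 0" "q\<^sup>2 = 2/3" by (simp_all add: q_def)
  have q': "sqrt (2 * pi * q\<^sup>2) = q * sqrt (2 * pi)"
    using q(1) by (simp add: real_sqrt_mult)
  \<comment> \<open>The new centre weights \<open>t\<close> and \<open>u\<close> by their
    coefficients 1/4 and 1/2; the variance is 1 / (2 (1/4 + 1/2)) = 2/3.\<close>
  have 2: "- (x - t)\<^sup>2 / 4 + - (x - u)\<^sup>2 / 2 = - (u - t)\<^sup>2 / 6 + - (x - (t + 2 * u) / 3)\<^sup>2 / (2 * q\<^sup>2)"
    unfolding q(2) by (simp add: power2_eq_square field_simps)
  have "exp (- (x - t)\<^sup>2 / 4) * normal_density u 1 x =
      1 / sqrt (2 * pi) * (exp (- (x - t)\<^sup>2 / 4) * exp (- (x - u)\<^sup>2 / 2))"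
    by (simp add: normal_density_def)
  also have "\<dots> = 1 / sqrt (2 * pi) * (exp (- (u - t)\<^sup>2 / 6) * exp (- (x - (t + 2 * u) / 3)\<^sup>2 / (2 * q\<^sup>2)))"
    unfolding exp_add[symmetric] 2 ..
  also have "\<dots> = q * exp (- (u - t)\<^sup>2 / 6) * normal_density ((t + 2 * u) / 3) q x"
    unfolding normal_density_def q' using q(1) by simp
  finally show ?thesis unfolding q_def .
qed

text \<open>Two densities at \<open>t\<close> over one at \<open>u\<close> leave the quadratic
  coefficient 1/2, hence a Gaussian again, centred at the reflection of \<open>u\<close> in
  \<open>t\<close>. Its mass is the second moment behind the divergence of order 2.\<close>

lemma normal_density_sq_div:
  "normal_density t 1 x * normal_density t 1 x / normal_density u 1 x =
    exp ((u - t)\<^sup>2) * normal_density (2 * t - u) 1 x"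
proof -
  have 2: "- (x - t)\<^sup>2 / 2 + - (x - t)\<^sup>2 / 2 - (- (x - u)\<^sup>2 / 2) = (u - t)\<^sup>2 + - (x - (2 * t - u))\<^sup>2 / 2"
    by (simp add: power2_eq_square field_simps)
  have "exp (- (x - t)\<^sup>2 / 2) * exp (- (x - t)\<^sup>2 / 2) / exp (- (x - u)\<^sup>2 / 2) =
      exp ((u - t)\<^sup>2) * exp (- (x - (2 * t - u))\<^sup>2 / 2)"
    unfolding exp_add[symmetric] exp_diff[symmetric] 2 ..
  then show ?thesis
    unfolding normal_density_def by (simp add: field_simps)
qed

lemma likelihood_pos: "likelihood p \<theta> Y > 0"
  unfolding likelihood_def by (intro prod_pos) (auto intro: normal_density_pos)

lemma likelihood_measurable_pair:
  "(\<lambda>(\<theta>, Y). likelihood p \<theta> Y) \<in> borel_measurable (PiM {1..p} (\<lambda>_. borel) \<Otimes>\<^sub>M PiM {1..p} (\<lambda>_. borel))"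
  unfolding likelihood_def normal_density_def by measurable

lemma likelihood_measurable1[measurable]:
  "(\<lambda>\<theta>. likelihood p \<theta> Y) \<in> borel_measurable (PiM {1..p} (\<lambda>_. borel))"
  unfolding likelihood_def normal_density_def by measurable

lemma likelihood_measurable2[measurable]:
  "(\<lambda>Y. likelihood p \<theta> Y) \<in> borel_measurable (PiM {1..p} (\<lambda>_. borel))"
  unfolding likelihood_def normal_density_def by measurable

text \<open>This keeps all slab marginals finite, so that the evidence can be treated as a real
  function of the weight.\<close>

lemma likelihood_le_1: "likelihood p \<theta> Y \<le> 1"
proof -
  have "sqrt (2 * pi) \<ge> 1" using pi_gt3 by simp
  then have "1 / sqrt (2 * pi) * exp (- (y - m)\<^sup>2 / 2) \<le> 1" for m y
    by (intro mult_le_one) auto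
  then have "normal_density m 1 y \<le> 1" for m y
    by (simp add: normal_density_def)
  then show ?thesis unfolding likelihood_def by (intro prod_le_1) auto
qed

lemma sets_PiM_lborel: "sets (PiM {1..p} (\<lambda>_. lborel)) = sets (PiM {1..p} (\<lambda>_. borel :: real measure))"
  by (rule sets_PiM_cong) auto

lemma sets_gauss[measurable_cong, simp]: "sets (gauss p \<theta>) = sets (PiM {1..p} (\<lambda>_. borel))"
  unfolding gauss_def by (simp only: sets_density sets_PiM_lborel)

lemma space_gauss[simp]: "space (gauss p \<theta>) = vecs p"
  by (simp add: gauss_def space_PiM vecs_def)

lemma space_Gamma_prior[simp]: "space (Gamma_prior p \<tau> S) = vecs p"
  by (simp add: Gamma_prior_def space_PiM vecs_def PiE_def Pi_def)

lemma space_spike_slab[simp]: "space (spike_slab p \<tau> l) = vecs p"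
  by (simp add: spike_slab_def space_PiM vecs_def)

lemma nn_integral_gauss:
  assumes "f \<in> borel_measurable (PiM {1..p} (\<lambda>_. borel))"
  shows "(\<integral>\<^sup>+Y. f Y \<partial>gauss p \<theta>) = (\<integral>\<^sup>+Y. ennreal (likelihood p \<theta> Y) * f Y \<partial>PiM {1..p} (\<lambda>_. lborel))"
  unfolding gauss_def
  by (rule nn_integral_density)
    (use assms likelihood_measurable2 in \<open>simp_all add: measurable_cong_sets[OF sets_PiM_lborel refl]\<close>)

lemma nn_integral_gauss_prod:
  assumes "\<And>j. j \<in> {1..p} \<Longrightarrow> f j \<in> borel_measurable borel" "\<And>j x. j \<in> {1..p} \<Longrightarrow> f j x \<ge> 0"
  shows "(\<integral>\<^sup>+Y. ennreal (\<Prod>j\<in>{1..p}. f j (Y j)) \<partial>gauss p \<theta>) =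
    (\<Prod>j\<in>{1..p}. \<integral>\<^sup>+x. ennreal (f j x * normal_density (\<theta> j) 1 x) \<partial>lborel)"
proof -
  interpret product_sigma_finite "\<lambda>_::nat. lborel :: real measure" ..
  note [measurable] = assms(1)
  have eq: "ennreal (likelihood p \<theta> Y) * ennreal (\<Prod>j\<in>{1..p}. f j (Y j)) =
      (\<Prod>j\<in>{1..p}. ennreal (f j (Y j) * normal_density (\<theta> j) 1 (Y j)))" for Y
  proof -
    have "ennreal (likelihood p \<theta> Y) * ennreal (\<Prod>j\<in>{1..p}. f j (Y j)) =
        ennreal (likelihood p \<theta> Y * (\<Prod>j\<in>{1..p}. f j (Y j)))"
      by (rule ennreal_mult'[symmetric]) (rule less_imp_le[OF likelihood_pos])
    also have "\<dots> = ennreal (\<Prod>j\<in>{1..p}. f j (Y j) * normal_density (\<theta> j) 1 (Y j))"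
      by (simp only: likelihood_def prod.distrib mult.commute)
    also have "\<dots> = (\<Prod>j\<in>{1..p}. ennreal (f j (Y j) * normal_density (\<theta> j) 1 (Y j)))"
      by (rule prod_ennreal[symmetric]) (simp add: assms(2))
    finally show ?thesis .
  qed
  have "(\<lambda>Y. \<Prod>j\<in>{1..p}. f j (Y j)) \<in> borel_measurable (PiM {1..p} (\<lambda>_. borel))"
    by measurable
  then have "(\<integral>\<^sup>+Y. ennreal (\<Prod>j\<in>{1..p}. f j (Y j)) \<partial>gauss p \<theta>) =
    (\<integral>\<^sup>+Y. (\<Prod>j\<in>{1..p}. ennreal (f j (Y j) * normal_density (\<theta> j) 1 (Y j))) \<partial>PiM {1..p} (\<lambda>_. lborel))"
    by (subst nn_integral_gauss) (simp_all add: eq)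
  also have "\<dots> = (\<Prod>j\<in>{1..p}. \<integral>\<^sup>+x. ennreal (f j x * normal_density (\<theta> j) 1 x) \<partial>lborel)"
    by (rule product_nn_integral_prod) auto
  finally show ?thesis .
qed

lemma prob_space_gauss: "prob_space (gauss p \<theta>)"
proof
  show "emeasure (gauss p \<theta>) (space (gauss p \<theta>)) = 1"
    using nn_integral_gauss_prod[of p "\<lambda>_ _. 1" \<theta>]
    by (simp add: nn_integral_normal_density)
qed

lemma sq_dist_eq: "sq_dist p x y = (\<Sum>j\<in>{1..p}. (x j - y j)\<^sup>2)"
  unfolding sq_dist_def L2_set_def by (simp add: sum_nonneg)

lemma sq_dist_measurable[measurable]: "(\<lambda>x. sq_dist p x y) \<in> borel_measurable (PiM {1..p} (\<lambda>_. borel))"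
  unfolding sq_dist_eq by measurable

text \<open>Used twice: for the divergence of order 2, and for the mean of \<open>inv_ratio\<close>
  over a ball.\<close>

lemma nn_integral_likelihood_ratio:
  "(\<integral>\<^sup>+Y. ennreal (likelihood p t Y / likelihood p u Y) \<partial>gauss p t) = ennreal (exp (sq_dist p u t))"
proof -
  have "(\<integral>\<^sup>+Y. ennreal (likelihood p t Y / likelihood p u Y) \<partial>gauss p t) =
     (\<integral>\<^sup>+Y. ennreal (\<Prod>j\<in>{1..p}. normal_density (t j) 1 (Y j) / normal_density (u j) 1 (Y j)) \<partial>gauss p t)"
    by (simp add: likelihood_def prod_dividef)
  also have "\<dots> = (\<Prod>j\<in>{1..p}. ennreal (exp ((u j - t j)\<^sup>2)))"
    by (subst nn_integral_gauss_prod)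
      (auto intro!: prod.cong simp: normal_density_sq_div nn_integral_normal_density_cmult)
  also have "\<dots> = ennreal (exp (sq_dist p u t))"
    by (simp add: prod_ennreal exp_sum sq_dist_eq)
  finally show ?thesis .
qed

lemma gauss_density: "gauss p t = density (gauss p u) (\<lambda>Y. ennreal (likelihood p t Y / likelihood p u Y))"
proof -
  have 1: "(\<lambda>Y. likelihood p t Y / likelihood p u Y) \<in> borel_measurable (PiM {1..p} (\<lambda>_. lborel))"
    "(\<lambda>Y. likelihood p t Y) \<in> borel_measurable (PiM {1..p} (\<lambda>_. lborel))"
    "(\<lambda>Y. likelihood p u Y) \<in> borel_measurable (PiM {1..p} (\<lambda>_. lborel))"
    unfolding measurable_cong_sets[OF sets_PiM_lborel refl] by measurable
  have "likelihood p u Y * (likelihood p t Y / likelihood p u Y) = likelihood p t Y" for Y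
    using likelihood_pos[of p u Y] by simp
  then show ?thesis
    unfolding gauss_def using 1 likelihood_pos
    by (subst density_density_eq) (simp_all add: less_imp_le flip: ennreal_mult')
qed

lemma renyi_2_gauss: "renyi 2 (gauss p t) (gauss p u) = ereal (sq_dist p u t)"
proof -
  interpret U: prob_space "gauss p u" by (rule prob_space_gauss)
  let ?f = "\<lambda>Y. likelihood p t Y / likelihood p u Y"
  have [measurable]: "?f \<in> borel_measurable (gauss p u)" "?f \<in> borel_measurable (gauss p t)" by measurable
  have ac: "absolutely_continuous (gauss p u) (gauss p t)"
    by (subst gauss_density[of p t u]) (auto intro!: absolutely_continuousI_density)
  have "AE Y in gauss p u. ennreal (?f Y) = RN_deriv (gauss p u) (gauss p t) Y"
    by (rule U.RN_deriv_unique) (auto simp flip: gauss_density)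
  \<comment> \<open>The derivative is unique up to null sets of \<open>gauss p u\<close>; absolute
    continuity carries this over to \<open>gauss p t\<close>, against which the divergence
    integrates.\<close>
  then have ae: "AE Y in gauss p t. ennreal (?f Y) = RN_deriv (gauss p u) (gauss p t) Y"
    by (rule absolutely_continuous_AE[rotated 2]) (use ac in auto)
  have "(\<integral>\<^sup>+Y. ennreal (enn2real (RN_deriv (gauss p u) (gauss p t) Y) powr (2 - 1)) \<partial>gauss p t) =
     (\<integral>\<^sup>+Y. ennreal (?f Y) \<partial>gauss p t)"
  proof (rule nn_integral_cong_AE)
    show "AE Y in gauss p t. ennreal (enn2real (RN_deriv (gauss p u) (gauss p t) Y) powr (2 - 1)) = ennreal (?f Y)"
      using ae
    proof eventually_elim
      case (elim Y)
      show ?case unfolding elim[symmetric] using likelihood_pos[of p t Y] likelihood_pos[of p u Y] by simp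
    qed
  qed
  then show ?thesis
    unfolding renyi_def by (simp add: ac nn_integral_likelihood_ratio ext_ln_def)
qed

subsection \<open>The test and one-dimensional Laplace bounds\<close>

lemma prod_ennreal_le_exp_sum:
  fixes f :: "'a \<Rightarrow> ennreal"
  assumes "\<And>i. i \<in> A \<Longrightarrow> f i \<le> ennreal (exp (g i))"
  shows "prod f A \<le> ennreal (exp (sum g A))"
proof (cases "finite A")
  case True
  have "prod f A \<le> (\<Prod>i\<in>A. ennreal (exp (g i)))"
    by (rule prod_mono_ennreal) (rule assms)
  also have "\<dots> = ennreal (exp (sum g A))"
    using True by (simp add: prod_ennreal exp_sum)
  finally show ?thesis .
qed simp

lemma ennreal_exp_sum_le_prod:
  fixes f :: "'a \<Rightarrow> ennreal"
  assumes "finite A" "\<And>i. i \<in> A \<Longrightarrow> ennreal (exp (g i)) \<le> f i"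
  shows "ennreal (exp (sum g A)) \<le> prod f A"
proof -
  have "ennreal (exp (sum g A)) = (\<Prod>i\<in>A. ennreal (exp (g i)))"
    using assms(1) by (simp add: prod_ennreal exp_sum)
  also have "\<dots> \<le> prod f A"
    by (rule prod_mono_ennreal) (rule assms(2))
  finally show ?thesis .
qed

lemma ThetaD: "\<theta> \<in> Theta p S \<Longrightarrow> j \<in> {1..p} \<Longrightarrow> j \<notin> S \<Longrightarrow> \<theta> j = 0"
  by (auto simp: Theta_def)

lemma Theta_sets[measurable]: "Theta p S \<in> sets (PiM {1..p} (\<lambda>_. borel))"
proof -
  have "{\<theta> \<in> space (PiM {1..p} (\<lambda>_. borel)). \<forall>j\<in>{1..p} - S. \<theta> j = (0::real)} \<in> sets (PiM {1..p} (\<lambda>_. borel))"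
    by measurable
  then show ?thesis by (simp add: Theta_def vecs_def space_PiM)
qed

lemma vecs_sets[measurable]: "vecs p \<in> sets (PiM {1..p} (\<lambda>_. borel))"
  using sets.top[of "PiM {1..p} (\<lambda>_. borel :: real measure)"] by (simp add: vecs_def space_PiM)

text \<open>The weight p^-3 per coordinate keeps the product over all p coordinates bounded in mean
  under the null; \<open>exp (- 3 * r)\<close> then sets the level.\<close>

definition test_stat :: "nat \<Rightarrow> real \<Rightarrow> (nat \<Rightarrow> real) \<Rightarrow> (nat \<Rightarrow> real) \<Rightarrow> real" where
  "test_stat p r t Y = exp (- 3 * r) * (\<Prod>j\<in>{1..p}. 1 + exp (- 3 * ln (real p)) * exp ((Y j - t j)\<^sup>2 / 4))"

lemma test_stat_pos: "test_stat p r t Y > 0"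
  unfolding test_stat_def by (intro mult_pos_pos prod_pos) (auto intro: add_pos_pos)

lemma test_stat_measurable[measurable]:
  "test_stat p r t \<in> borel_measurable (PiM {1..p} (\<lambda>_. borel))"
  unfolding test_stat_def[abs_def] by measurable

text \<open>Each factor has mean \<open>1 + c * sqrt 2 \<le> 1 + 1 / p \<le> exp (1 / p)\<close>, so
  the p factors together contribute a single e.\<close>

lemma nn_integral_test_stat:
  assumes "p \<ge> 2"
  shows "(\<integral>\<^sup>+Y. ennreal (test_stat p r t Y) \<partial>gauss p t) \<le> ennreal (exp (1 - 3 * r))"
proof -
  define c where "c = exp (- 3 * ln (real p))"
  have c: "c * sqrt 2 \<le> 1 / real p"
  proof -
    have "c = 1 / real p ^ 3"
      using assms exp_of_nat_mult[of 3 "ln (real p)"] by (simp add: c_def exp_minus field_simps)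
    moreover have "sqrt 2 \<le> sqrt (2\<^sup>2)" by (subst real_sqrt_le_iff) simp
    moreover have "2 \<le> real p" using assms by simp
    then have "2\<^sup>2 \<le> (real p)\<^sup>2" by (rule power_mono) simp
    ultimately have "c * sqrt 2 \<le> (real p)\<^sup>2 / real p ^ 3"
      using divide_right_mono[of "sqrt 2" "(real p)\<^sup>2" "real p ^ 3"] by simp
    also have "\<dots> = 1 / real p"
      using assms by (simp add: power2_eq_square power3_eq_cube)
    finally show ?thesis .
  qed
  have "(\<integral>\<^sup>+Y. ennreal (\<Prod>j\<in>{1..p}. 1 + c * exp ((Y j - t j)\<^sup>2 / 4)) \<partial>gauss p t) =
      (\<Prod>j\<in>{1..p}. \<integral>\<^sup>+x. ennreal ((1 + c * exp ((x - t j)\<^sup>2 / 4)) * normal_density (t j) 1 x) \<partial>lborel)"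
    by (rule nn_integral_gauss_prod) (auto simp: c_def intro: add_nonneg_nonneg)
  also have "\<dots> \<le> ennreal (exp (\<Sum>j\<in>{1..p}. 1 / real p))"
  proof (rule prod_ennreal_le_exp_sum)
    fix j
    have "(\<integral>\<^sup>+x. ennreal ((1 + c * exp ((x - t j)\<^sup>2 / 4)) * normal_density (t j) 1 x) \<partial>lborel) =
       (\<integral>\<^sup>+x. ennreal (1 * normal_density (t j) 1 x) + ennreal (c * sqrt 2 * normal_density (t j) (sqrt 2) x) \<partial>lborel)"
      by (intro nn_integral_cong)
        (simp add: c_def distrib_right mult.assoc exp_quarter_times_normal_density flip: ennreal_plus)
    also have "\<dots> = ennreal (1 + c * sqrt 2)"
      by (subst nn_integral_add) (simp_all add: nn_integral_normal_density_cmult nn_integral_normal_density c_def)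
    also have "\<dots> \<le> ennreal (exp (1 / real p))"
      using c exp_ge_add_one_self[of "1 / real p"] by (intro ennreal_leI) linarith
    finally show "(\<integral>\<^sup>+x. ennreal ((1 + c * exp ((x - t j)\<^sup>2 / 4)) * normal_density (t j) 1 x) \<partial>lborel)
      \<le> ennreal (exp (1 / real p))" .
  qed
  also have "(\<Sum>j\<in>{1..p}. 1 / real p) = 1" using assms by simp
  finally have *: "(\<integral>\<^sup>+Y. ennreal (\<Prod>j\<in>{1..p}. 1 + c * exp ((Y j - t j)\<^sup>2 / 4)) \<partial>gauss p t) \<le> ennreal (exp 1)" .
  have "(\<integral>\<^sup>+Y. ennreal (test_stat p r t Y) \<partial>gauss p t) =
     (\<integral>\<^sup>+Y. ennreal (exp (- 3 * r)) * ennreal (\<Prod>j\<in>{1..p}. 1 + c * exp ((Y j - t j)\<^sup>2 / 4)) \<partial>gauss p t)"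
    unfolding test_stat_def c_def by (simp only: ennreal_mult' exp_ge_zero)
  also have "\<dots> = ennreal (exp (- 3 * r)) * (\<integral>\<^sup>+Y. ennreal (\<Prod>j\<in>{1..p}. 1 + c * exp ((Y j - t j)\<^sup>2 / 4)) \<partial>gauss p t)"
    by (rule nn_integral_cmult) measurable
  also have "\<dots> \<le> ennreal (exp (- 3 * r)) * ennreal (exp 1)"
    by (intro mult_left_mono *) simp
  also have "\<dots> = ennreal (exp (1 - 3 * r))"
    by (subst ennreal_mult'[symmetric]) (simp_all flip: exp_add)
  finally show ?thesis .
qed

lemma sum_if_const:
  fixes c :: real
  assumes "A \<subseteq> {1..p::nat}"
  shows "(\<Sum>j\<in>{1..p}. if j \<in> A then c else 0) = c * real (card A)"
proof -
  have "(\<Sum>j\<in>{1..p}. if j \<in> A then c else 0) = (\<Sum>j\<in>A. c)"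
    using assms by (intro sum.mono_neutral_cong_right) auto
  then show ?thesis by simp
qed

text \<open>Off \<open>S \<union> T\<close> the factors of \<open>1 / X\<close> are at most 1; on \<open>S \<union> T\<close> only the exponential part is kept.\<close>

lemma nn_integral_inverse_test_stat:
  assumes "p \<ge> 2" "S \<subseteq> {1..p}" "T \<subseteq> {1..p}" "u \<in> Theta p S" "t \<in> Theta p T"
  shows "(\<integral>\<^sup>+Y. ennreal (1 / test_stat p r t Y) \<partial>gauss p u) \<le>
    ennreal (exp (3 * r + 3 * ln (real p) * real (card (S \<union> T)) - sq_dist p u t / 6))"
proof -
  define c where "c = exp (- 3 * ln (real p))"
  have c: "c > 0" "1 / c = exp (3 * ln (real p))" by (simp_all add: c_def exp_minus field_simps)
  define g where "g j x = 1 / (1 + c * exp ((x - t j)\<^sup>2 / 4))" for j x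
  have g0: "g j x \<ge> 0" "g j x \<le> 1" for j x
    using c(1) by (simp_all add: g_def add_pos_pos divide_le_eq_1)
  have [measurable]: "g j \<in> borel_measurable borel" for j
    unfolding g_def[abs_def] by measurable
  have g1: "g j x \<le> exp (3 * ln (real p)) * exp (- (x - t j)\<^sup>2 / 4)" for j x
  proof -
    \<comment> \<open>Dropping the 1 in the denominator costs \<open>1 / c\<close>, that is p^3;
      this is paid on \<open>S \<union> T\<close> only.\<close>
    have "g j x \<le> 1 / (c * exp ((x - t j)\<^sup>2 / 4))"
      unfolding g_def using c(1) by (intro divide_left_mono mult_pos_pos add_pos_pos) auto
    also have "\<dots> = exp (3 * ln (real p)) * exp (- (x - t j)\<^sup>2 / 4)"
      unfolding c(2)[symmetric] by (simp add: exp_minus field_simps)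
    finally show ?thesis .
  qed
  have "(\<integral>\<^sup>+Y. ennreal (\<Prod>j\<in>{1..p}. g j (Y j)) \<partial>gauss p u) =
      (\<Prod>j\<in>{1..p}. \<integral>\<^sup>+x. ennreal (g j x * normal_density (u j) 1 x) \<partial>lborel)"
    by (rule nn_integral_gauss_prod) (auto simp: g0)
  also have "\<dots> \<le> ennreal (exp (\<Sum>j\<in>{1..p}. (if j \<in> S \<union> T then 3 * ln (real p) else 0) - (u j - t j)\<^sup>2 / 6))"
  proof (rule prod_ennreal_le_exp_sum)
    fix j assume j: "j \<in> {1..p}"
    show "(\<integral>\<^sup>+x. ennreal (g j x * normal_density (u j) 1 x) \<partial>lborel) \<le>
      ennreal (exp ((if j \<in> S \<union> T then 3 * ln (real p) else 0) - (u j - t j)\<^sup>2 / 6))"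
    proof (cases "j \<in> S \<union> T")
      case True
      have "(\<integral>\<^sup>+x. ennreal (g j x * normal_density (u j) 1 x) \<partial>lborel) \<le>
        (\<integral>\<^sup>+x. ennreal ((exp (3 * ln (real p)) * sqrt (2/3) * exp (- (u j - t j)\<^sup>2 / 6))
            * normal_density ((t j + 2 * u j) / 3) (sqrt (2/3)) x) \<partial>lborel)"
      proof (intro nn_integral_mono ennreal_leI)
        fix x
        have "g j x * normal_density (u j) 1 x \<le>
            exp (3 * ln (real p)) * exp (- (x - t j)\<^sup>2 / 4) * normal_density (u j) 1 x"
          by (intro mult_right_mono g1) simp
        also have "\<dots> = (exp (3 * ln (real p)) * sqrt (2/3) * exp (- (u j - t j)\<^sup>2 / 6))
            * normal_density ((t j + 2 * u j) / 3) (sqrt (2/3)) x"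
          by (simp only: mult.assoc exp_neg_quarter_times_normal_density)
        finally show "g j x * normal_density (u j) 1 x \<le> (exp (3 * ln (real p)) * sqrt (2/3) * exp (- (u j - t j)\<^sup>2 / 6))
            * normal_density ((t j + 2 * u j) / 3) (sqrt (2/3)) x" .
      qed
      also have "\<dots> = ennreal (exp (3 * ln (real p)) * sqrt (2/3) * exp (- (u j - t j)\<^sup>2 / 6))"
        by (rule nn_integral_normal_density_cmult) auto
      also have "\<dots> \<le> ennreal (exp (3 * ln (real p)) * 1 * exp (- (u j - t j)\<^sup>2 / 6))"
        by (intro ennreal_leI mult_right_mono mult_left_mono) auto
      also have "\<dots> = ennreal (exp ((if j \<in> S \<union> T then 3 * ln (real p) else 0) - (u j - t j)\<^sup>2 / 6))"
        using True by (simp flip: exp_add)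
      finally show ?thesis .
    next
      case False
      then have "u j = 0" "t j = 0" using assms j by (auto intro: ThetaD)
      moreover have "(\<integral>\<^sup>+x. ennreal (g j x * normal_density (u j) 1 x) \<partial>lborel) \<le>
        (\<integral>\<^sup>+x. ennreal (normal_density (u j) 1 x) \<partial>lborel)"
        using g0 by (intro nn_integral_mono ennreal_leI) (simp add: mult_left_le_one_le)
      ultimately show ?thesis using False by (simp add: nn_integral_normal_density)
    qed
  qed
  also have "(\<Sum>j\<in>{1..p}. (if j \<in> S \<union> T then 3 * ln (real p) else 0) - (u j - t j)\<^sup>2 / 6) =
      3 * ln (real p) * real (card (S \<union> T)) - sq_dist p u t / 6"
    unfolding sum_subtractf sq_dist_eq sum_divide_distrib
    using assms by (subst sum_if_const) auto
  finally have *: "(\<integral>\<^sup>+Y. ennreal (\<Prod>j\<in>{1..p}. g j (Y j)) \<partial>gauss p u) \<le> ennreal (exp (3 * ln (real p) * real (card (S \<union> T)) - sq_dist p u t / 6))" .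
  have "1 / test_stat p r t Y = exp (3 * r) * (\<Prod>j\<in>{1..p}. g j (Y j))" for Y
    unfolding test_stat_def g_def c_def[symmetric] prod_dividef by (simp add: exp_minus field_simps)
  then have "(\<integral>\<^sup>+Y. ennreal (1 / test_stat p r t Y) \<partial>gauss p u) =
      (\<integral>\<^sup>+Y. ennreal (exp (3 * r)) * ennreal (\<Prod>j\<in>{1..p}. g j (Y j)) \<partial>gauss p u)"
    by (simp only: ennreal_mult' exp_ge_zero)
  also have "\<dots> = ennreal (exp (3 * r)) * (\<integral>\<^sup>+Y. ennreal (\<Prod>j\<in>{1..p}. g j (Y j)) \<partial>gauss p u)"
    by (rule nn_integral_cmult) measurable
  also have "\<dots> \<le> ennreal (exp (3 * r)) * ennreal (exp (3 * ln (real p) * real (card (S \<union> T)) - sq_dist p u t / 6))"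
    by (intro mult_left_mono *) simp
  also have "\<dots> = ennreal (exp (3 * r + 3 * ln (real p) * real (card (S \<union> T)) - sq_dist p u t / 6))"
    by (subst ennreal_mult'[symmetric]) (simp_all add: add_diff_eq flip: exp_add)
  finally show ?thesis .
qed

text \<open>The triangle inequality trades \<open>exp (- \<tau> * \<bar>x\<bar>)\<close> for
  \<open>exp (- \<tau> * \<bar>t\<bar>)\<close> at the price
  \<open>exp (\<tau> * \<bar>x - t\<bar>)\<close>. Half of the exponent 1/16 pays for it, by
  \<open>\<tau> * d \<le> d\<^sup>2 / 32 + 8 * \<tau>\<^sup>2\<close>; the other half is the kernel
  of a normal law with deviation 4.\<close>

lemma nn_integral_laplace_bump_le:
  assumes "\<tau> > 0"
  shows "(\<integral>\<^sup>+x. ennreal (exp (- (x - t)\<^sup>2 / 16)) \<partial>laplace \<tau>) \<le>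
    ennreal ((1 + 6 * \<tau>) * exp (8 * \<tau>\<^sup>2) * exp (- \<tau> * \<bar>t\<bar>))"
proof -
  define A where "A = 2 * \<tau> * sqrt (2 * pi) * exp (8 * \<tau>\<^sup>2)"
  have pw: "(\<tau> / 2 * exp (- \<tau> * \<bar>x\<bar>)) * exp (- (x - t)\<^sup>2 / 16) \<le> (A * exp (- \<tau> * \<bar>t\<bar>)) * normal_density t 4 x" for x
  proof -
    have "\<tau> * d \<le> d\<^sup>2 / 32 + 8 * \<tau>\<^sup>2" for d
      using zero_le_power2[of "d - 16 * \<tau>"] by (simp add: power2_eq_square field_simps)
    from this[of "\<bar>x - t\<bar>"] have 1: "\<tau> * \<bar>x - t\<bar> \<le> (x - t)\<^sup>2 / 32 + 8 * \<tau>\<^sup>2"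
      by simp
    have "\<tau> * \<bar>t\<bar> \<le> \<tau> * (\<bar>x\<bar> + \<bar>x - t\<bar>)" using assms by (intro mult_left_mono) auto
    with 1 have "- \<tau> * \<bar>x\<bar> + - (x - t)\<^sup>2 / 16 \<le> 8 * \<tau>\<^sup>2 + - \<tau> * \<bar>t\<bar> + - (x - t)\<^sup>2 / 32"
      by (simp add: distrib_left)
    then have "exp (- \<tau> * \<bar>x\<bar> + - (x - t)\<^sup>2 / 16) \<le> exp (8 * \<tau>\<^sup>2 + - \<tau> * \<bar>t\<bar> + - (x - t)\<^sup>2 / 32)" by simp
    then have 2: "\<tau> / 2 * exp (- \<tau> * \<bar>x\<bar> + - (x - t)\<^sup>2 / 16) \<le> \<tau> / 2 * exp (8 * \<tau>\<^sup>2 + - \<tau> * \<bar>t\<bar> + - (x - t)\<^sup>2 / 32)"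
      using assms by (intro mult_left_mono) auto
    have s: "sqrt (2 * pi * 4\<^sup>2) = 4 * sqrt (2 * pi)"
      unfolding real_sqrt_mult by simp
    have "(A * exp (- \<tau> * \<bar>t\<bar>)) * normal_density t 4 x =
       \<tau> / 2 * (exp (8 * \<tau>\<^sup>2) * exp (- \<tau> * \<bar>t\<bar>) * exp (- (x - t)\<^sup>2 / 32))"
      unfolding normal_density_def s A_def by simp
    with 2 show ?thesis by (simp only: exp_add mult.assoc)
  qed
  \<comment> \<open>The 6 is 2 times 3, from \<open>sqrt (2 * pi) \<le> 3\<close>; the added 1 makes
    the constant at least 1, so that it also covers spike coordinates.\<close>
  have "sqrt (2 * pi) \<le> sqrt (3\<^sup>2)" using pi_less_4 by (subst real_sqrt_le_iff) simp
  then have "(2 * \<tau>) * sqrt (2 * pi) \<le> (2 * \<tau>) * 3"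
    using assms by (intro mult_left_mono) auto
  then have "2 * \<tau> * sqrt (2 * pi) \<le> 1 + 6 * \<tau>" by simp
  then have A: "0 \<le> A" "A \<le> (1 + 6 * \<tau>) * exp (8 * \<tau>\<^sup>2)"
    unfolding A_def using assms by (auto intro: mult_right_mono)
  have "(\<integral>\<^sup>+x. ennreal (exp (- (x - t)\<^sup>2 / 16)) \<partial>laplace \<tau>) =
    (\<integral>\<^sup>+x. ennreal ((\<tau> / 2 * exp (- \<tau> * \<bar>x\<bar>)) * exp (- (x - t)\<^sup>2 / 16)) \<partial>lborel)"
    unfolding laplace_def using assms
    by (subst nn_integral_density, simp, simp) (intro nn_integral_cong ennreal_mult'[symmetric], simp)
  also have "\<dots> \<le> (\<integral>\<^sup>+x. ennreal ((A * exp (- \<tau> * \<bar>t\<bar>)) * normal_density t 4 x) \<partial>lborel)"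
    by (intro nn_integral_mono ennreal_leI pw)
  also have "\<dots> = ennreal (A * exp (- \<tau> * \<bar>t\<bar>))"
    using A by (intro nn_integral_normal_density_cmult) auto
  also have "\<dots> \<le> ennreal ((1 + 6 * \<tau>) * exp (8 * \<tau>\<^sup>2) * exp (- \<tau> * \<bar>t\<bar>))"
    using A by (intro ennreal_leI mult_right_mono) auto
  finally show ?thesis .
qed

text \<open>The spike counterpart: at a coordinate fixed to 0 the bump equals the left side. The
  square gives \<open>4 * \<tau>\<^sup>2\<close>, relaxed to \<open>8 * \<tau>\<^sup>2\<close> to
  share the constant of the slab.\<close>

lemma exp_neg_sq_le_exp_neg_abs:
  "exp (- t\<^sup>2 / 16) \<le> exp (8 * \<tau>\<^sup>2) * exp (- \<tau> * \<bar>t\<bar> :: real)"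
proof -
  have "\<tau> * \<bar>t\<bar> \<le> t\<^sup>2 / 16 + 4 * \<tau>\<^sup>2"
    using zero_le_power2[of "\<bar>t\<bar> - 8 * \<tau>"]
    unfolding power2_diff by (simp add: power_mult_distrib mult_ac)
  moreover have "0 \<le> \<tau>\<^sup>2" by simp
  ultimately have "- t\<^sup>2 / 16 \<le> 8 * \<tau>\<^sup>2 + - \<tau> * \<bar>t\<bar>" unfolding minus_mult_left[symmetric] by linarith
  then show ?thesis by (simp flip: exp_add)
qed

text \<open>Within distance 1 of \<open>t\<close> the density drops by at most the factor
  \<open>exp (- \<tau>)\<close> from its value at \<open>t\<close>, and the interval has length
  2.\<close>

lemma emeasure_laplace_interval_ge:
  assumes "\<tau> > 0"
  shows "ennreal (\<tau> * exp (- \<tau>) * exp (- \<tau> * \<bar>t\<bar>)) \<le> emeasure (laplace \<tau>) {t - 1..t + 1}"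
proof -
  define c where "c = \<tau> / 2 * exp (- \<tau>) * exp (- \<tau> * \<bar>t\<bar>)"
  have c: "c \<ge> 0" using assms by (simp add: c_def)
  have "ennreal (\<tau> * exp (- \<tau>) * exp (- \<tau> * \<bar>t\<bar>)) = ennreal c * emeasure lborel {t - 1..t + 1}"
    using c by (simp add: c_def flip: ennreal_mult ennreal_numeral)
  also have "\<dots> = (\<integral>\<^sup>+x. ennreal c * indicator {t - 1..t + 1} x \<partial>lborel)"
    by (simp add: nn_integral_cmult_indicator)
  also have "\<dots> \<le> (\<integral>\<^sup>+x. ennreal (\<tau> / 2 * exp (- \<tau> * \<bar>x\<bar>)) * indicator {t - 1..t + 1} x \<partial>lborel)"
  proof (intro nn_integral_mono)
    fix x
    show "ennreal c * indicator {t - 1..t + 1} x \<le> ennreal (\<tau> / 2 * exp (- \<tau> * \<bar>x\<bar>)) * indicator {t - 1..t + 1} x"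
    proof (cases "x \<in> {t - 1..t + 1}")
      case True
      then have "\<tau> * \<bar>x\<bar> \<le> \<tau> * (1 + \<bar>t\<bar>)" using assms by (intro mult_left_mono) auto
      then have "c \<le> \<tau> / 2 * exp (- \<tau> * \<bar>x\<bar>)"
        using assms unfolding c_def mult.assoc by (simp add: distrib_left flip: exp_add)
      then show ?thesis by (intro mult_right_mono ennreal_leI) auto
    qed simp
  qed
  also have "\<dots> = emeasure (laplace \<tau>) {t - 1..t + 1}"
    unfolding laplace_def by (subst emeasure_density) auto
  finally show ?thesis .
qed

subsection \<open>Product bounds for the slab prior\<close>

text \<open>Logarithmic losses per coordinate in the upper and lower bounds on prior masses; the lower
  one comes from the interval of radius 1 around the true coordinate.\<close>

definition slab_upper_const :: "real \<Rightarrow> real" where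
  "slab_upper_const \<tau> = ln ((1 + 6 * \<tau>) * exp (8 * \<tau>\<^sup>2))"

definition slab_lower_const :: "real \<Rightarrow> real" where
  "slab_lower_const \<tau> = \<tau> - ln \<tau>"

text \<open>The ball of the divergence of order 2 with \<open>C3 = 2\<close>, made explicit through
  \<open>renyi_2_gauss\<close>.\<close>

definition theta_ball :: "nat \<Rightarrow> (nat \<Rightarrow> real) \<Rightarrow> nat set \<Rightarrow> real \<Rightarrow> (nat \<Rightarrow> real) set" where
  "theta_ball p t T r = {\<theta> \<in> Theta p T. sq_dist p \<theta> t \<le> 2 * r}"

lemma theta_ball_sets[measurable]: "theta_ball p t T r \<in> sets (PiM {1..p} (\<lambda>_. borel))"
proof -
  have "theta_ball p t T r = Theta p T \<inter> {\<theta> \<in> space (PiM {1..p} (\<lambda>_. borel)). sq_dist p \<theta> t \<le> 2 * r}"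
    by (auto simp: theta_ball_def Theta_def vecs_def space_PiM)
  also have "\<dots> \<in> sets (PiM {1..p} (\<lambda>_. borel))" by measurable
  finally show ?thesis .
qed

context
  fixes \<tau> :: real
  assumes \<tau>: "\<tau> > 0"
begin

lemma exp_slab_upper_const: "exp (slab_upper_const \<tau>) = (1 + 6 * \<tau>) * exp (8 * \<tau>\<^sup>2)"
  using \<tau> by (simp add: slab_upper_const_def add_pos_pos)

lemma slab_upper_const_nonneg: "slab_upper_const \<tau> \<ge> 0"
proof -
  have "exp 0 \<le> exp (slab_upper_const \<tau>)"
    unfolding exp_slab_upper_const using mult_mono[of 1 "1 + 6 * \<tau>" 1 "exp (8 * \<tau>\<^sup>2)"] \<tau> by simp
  then show ?thesis by simp
qed

lemma exp_slab_lower_const: "exp (- slab_lower_const \<tau>) = \<tau> * exp (- \<tau>)"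
  using \<tau> by (simp add: slab_lower_const_def exp_diff exp_minus field_simps)

lemma slab_lower_const_nonneg: "slab_lower_const \<tau> \<ge> 0"
  unfolding slab_lower_const_def using ln_le_minus_one[OF \<tau>] by simp

lemma nn_integral_Gamma_prior_prod:
  assumes "\<And>j. j \<in> {1..p} \<Longrightarrow> f j \<in> borel_measurable borel"
  shows "(\<integral>\<^sup>+\<theta>. (\<Prod>j\<in>{1..p}. f j (\<theta> j)) \<partial>Gamma_prior p \<tau> S) =
    (\<Prod>j\<in>{1..p}. \<integral>\<^sup>+x. f j x \<partial>(if j \<in> S then laplace \<tau> else return borel 0))"
proof -
  interpret product_sigma_finite "\<lambda>j. if j \<in> S then laplace \<tau> else return borel 0"
    by (auto simp: product_sigma_finite_def intro!: prob_space_imp_sigma_finite prob_space_laplace prob_space_return \<tau>)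
  show ?thesis unfolding Gamma_prior_def
    by (rule product_nn_integral_prod) (use assms in \<open>auto cong: measurable_cong_sets\<close>)
qed

text \<open>Off \<open>S \<union> T\<close> the spike meets \<open>t j = 0\<close> and the integral
  is exactly 1, so only \<open>card (S \<union> T)\<close> coordinates cost
  \<open>slab_upper_const\<close> each.\<close>

lemma nn_integral_Gamma_prior_bump_le:
  assumes "S \<subseteq> {1..p}" "T \<subseteq> {1..p}" "t \<in> Theta p T"
  shows "(\<integral>\<^sup>+\<theta>. ennreal (exp (- sq_dist p \<theta> t / 16)) \<partial>Gamma_prior p \<tau> S) \<le>
    ennreal (exp (slab_upper_const \<tau> * real (card (S \<union> T)) - \<tau> * (\<Sum>j\<in>{1..p}. \<bar>t j\<bar>)))"
proof -
  have "exp (- sq_dist p \<theta> t / 16) = (\<Prod>j\<in>{1..p}. exp (- (\<theta> j - t j)\<^sup>2 / 16))" for \<theta>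
    by (simp add: sq_dist_eq sum_divide_distrib sum_negf flip: exp_sum)
  then have "(\<integral>\<^sup>+\<theta>. ennreal (exp (- sq_dist p \<theta> t / 16)) \<partial>Gamma_prior p \<tau> S) =
      (\<integral>\<^sup>+\<theta>. (\<Prod>j\<in>{1..p}. ennreal (exp (- (\<theta> j - t j)\<^sup>2 / 16))) \<partial>Gamma_prior p \<tau> S)"
    by (simp add: prod_ennreal)
  also have "\<dots> = (\<Prod>j\<in>{1..p}. \<integral>\<^sup>+x. ennreal (exp (- (x - t j)\<^sup>2 / 16)) \<partial>(if j \<in> S then laplace \<tau> else return borel 0))"
    by (rule nn_integral_Gamma_prior_prod) auto
  also have "\<dots> \<le> ennreal (exp (\<Sum>j\<in>{1..p}. (if j \<in> S \<union> T then slab_upper_const \<tau> else 0) - \<tau> * \<bar>t j\<bar>))"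
  proof (rule prod_ennreal_le_exp_sum)
    fix j assume j: "j \<in> {1..p}"
    let ?I = "\<integral>\<^sup>+x. ennreal (exp (- (x - t j)\<^sup>2 / 16)) \<partial>(if j \<in> S then laplace \<tau> else return borel 0)"
    have eq: "exp (slab_upper_const \<tau> - \<tau> * \<bar>t j\<bar>) = (1 + 6 * \<tau>) * exp (8 * \<tau>\<^sup>2) * exp (- \<tau> * \<bar>t j\<bar>)"
      by (simp add: exp_diff exp_slab_upper_const exp_minus field_simps)
    consider "j \<in> S" | "j \<notin> S" "j \<in> T" | "j \<notin> S" "j \<notin> T" by blast
    then show "?I \<le> ennreal (exp ((if j \<in> S \<union> T then slab_upper_const \<tau> else 0) - \<tau> * \<bar>t j\<bar>))"
    proof cases
      case 1
      then show ?thesis using nn_integral_laplace_bump_le[OF \<tau>] by (simp add: eq)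
    next
      case 2
      have "exp (- (t j)\<^sup>2 / 16) \<le> 1 * (exp (8 * \<tau>\<^sup>2) * exp (- \<tau> * \<bar>t j\<bar>))"
        using exp_neg_sq_le_exp_neg_abs by simp
      also have "\<dots> \<le> (1 + 6 * \<tau>) * (exp (8 * \<tau>\<^sup>2) * exp (- \<tau> * \<bar>t j\<bar>))"
        using \<tau> by (intro mult_right_mono) auto
      finally show ?thesis using 2 by (simp add: nn_integral_return eq mult.assoc ennreal_leI)
    next
      case 3
      then show ?thesis using assms j ThetaD[of t p T j] by (simp add: nn_integral_return)
    qed
  qed
  also have "(\<Sum>j\<in>{1..p}. (if j \<in> S \<union> T then slab_upper_const \<tau> else 0) - \<tau> * \<bar>t j\<bar>) =
      slab_upper_const \<tau> * real (card (S \<union> T)) - \<tau> * (\<Sum>j\<in>{1..p}. \<bar>t j\<bar>)"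
    unfolding sum_subtractf sum_distrib_left[symmetric] using assms by (subst sum_if_const) auto
  finally show ?thesis .
qed

text \<open>The box with intervals of radius 1 on \<open>T\<close> and the point 0 elsewhere has a
  product mass and stays within squared distance \<open>card T\<close> of \<open>t\<close>, which
  fits into the ball because \<open>2 * ln p \<ge> 1\<close>.\<close>

lemma emeasure_theta_ball_ge:
  assumes "p \<ge> 2" "T \<subseteq> {1..p}" "t \<in> Theta p T"
  shows "ennreal (exp (- slab_lower_const \<tau> * real (card T) - \<tau> * (\<Sum>j\<in>{1..p}. \<bar>t j\<bar>))) \<le>
    emeasure (Gamma_prior p \<tau> T) (theta_ball p t T (real (card T) * ln (real p)))"
proof -
  let ?N = "\<lambda>j. if j \<in> T then laplace \<tau> else return borel 0"
  let ?B = "\<lambda>j. if j \<in> T then {t j - 1..t j + 1} else {0}"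
  interpret product_sigma_finite ?N
    by (auto simp: product_sigma_finite_def intro!: prob_space_imp_sigma_finite prob_space_laplace prob_space_return \<tau>)
  have "1 \<le> 2 * ln (real p)"
  proof -
    have "ln 2 \<le> ln (real p)" using assms(1) by simp
    moreover have "1 / 2 \<le> ln (2::real)" using ln2_ge_two_thirds by linarith
    ultimately show ?thesis by linarith
  qed
  then have r: "real (card T) \<le> 2 * (real (card T) * ln (real p))"
    using mult_left_mono[of 1 "2 * ln (real p)" "real (card T)"] by simp
  have "(\<Sum>j\<in>{1..p}. (if j \<in> T then - slab_lower_const \<tau> else 0) - \<tau> * \<bar>t j\<bar>) =
      - slab_lower_const \<tau> * real (card T) - \<tau> * (\<Sum>j\<in>{1..p}. \<bar>t j\<bar>)"
    unfolding sum_subtractf sum_distrib_left[symmetric] using assms by (subst sum_if_const) auto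
  then have "ennreal (exp (- slab_lower_const \<tau> * real (card T) - \<tau> * (\<Sum>j\<in>{1..p}. \<bar>t j\<bar>))) =
      ennreal (exp (\<Sum>j\<in>{1..p}. (if j \<in> T then - slab_lower_const \<tau> else 0) - \<tau> * \<bar>t j\<bar>))" by simp
  also have "\<dots> \<le> (\<Prod>j\<in>{1..p}. emeasure (?N j) (?B j))"
  proof (rule ennreal_exp_sum_le_prod)
    fix j assume j: "j \<in> {1..p}"
    show "ennreal (exp ((if j \<in> T then - slab_lower_const \<tau> else 0) - \<tau> * \<bar>t j\<bar>)) \<le> emeasure (?N j) (?B j)"
    proof (cases "j \<in> T")
      case True
      have "exp (- slab_lower_const \<tau> - \<tau> * \<bar>t j\<bar>) = \<tau> * exp (- \<tau>) * exp (- \<tau> * \<bar>t j\<bar>)"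
        unfolding exp_slab_lower_const[symmetric] by (simp flip: exp_add)
      with True show ?thesis using emeasure_laplace_interval_ge[OF \<tau>, of "t j"] by simp
    next
      case False
      then show ?thesis using assms j ThetaD[of t p T j] by simp
    qed
  qed simp
  also have "\<dots> = emeasure (Gamma_prior p \<tau> T) (PiE {1..p} ?B)"
    unfolding Gamma_prior_def by (rule emeasure_PiM[symmetric]) auto
  also have "\<dots> \<le> emeasure (Gamma_prior p \<tau> T) (theta_ball p t T (real (card T) * ln (real p)))"
  proof (rule emeasure_mono)
    show "PiE {1..p} ?B \<subseteq> theta_ball p t T (real (card T) * ln (real p))"
    proof
      fix \<theta> assume \<theta>: "\<theta> \<in> PiE {1..p} ?B"
      have B: "\<theta> j \<in> ?B j" if "j \<in> {1..p}" for j using \<theta> that by (rule PiE_mem)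
      have z: "\<theta> j = 0" if "j \<in> {1..p}" "j \<notin> T" for j
        using B[OF that(1)] that(2) by simp
      have "\<theta> \<in> extensional {1..p}" using \<theta> by (simp add: PiE_iff)
      then have "\<theta> \<in> Theta p T"
        using z by (auto simp: Theta_def vecs_def PiE_iff)
      have "sq_dist p \<theta> t \<le> (\<Sum>j\<in>{1..p}. if j \<in> T then 1 else 0)"
        unfolding sq_dist_eq
      proof (rule sum_mono)
        fix j assume j: "j \<in> {1..p}"
        show "(\<theta> j - t j)\<^sup>2 \<le> (if j \<in> T then 1 else 0)"
        proof (cases "j \<in> T")
          case True
          then have "\<bar>\<theta> j - t j\<bar> \<le> 1" using B[OF j] by (auto simp: abs_le_iff)
          then show ?thesis using True by (simp add: abs_square_le_1)
        next
          case False
          then show ?thesis using B[OF j] ThetaD[OF assms(3) j] by simp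
        qed
      qed
      then show "\<theta> \<in> theta_ball p t T (real (card T) * ln (real p))"
        using \<open>\<theta> \<in> Theta p T\<close> r assms(2) by (simp add: theta_ball_def sum_if_const)
    qed
  qed simp
  finally show ?thesis .
qed

text \<open>\<open>Gamma_prior\<close> is encoded as a measure on all of \<open>vecs p\<close>,
  whereas the error bound of the test speaks of points of \<open>Theta p S\<close>.\<close>

lemma AE_Gamma_prior_Theta: "AE \<theta> in Gamma_prior p \<tau> S. \<theta> \<in> Theta p S"
proof -
  have "AE \<theta> in Gamma_prior p \<tau> S. \<theta> j = 0" if "j \<in> {1..p} - S" for j
    unfolding Gamma_prior_def
    by (rule AE_PiM_component) (use that in \<open>auto intro!: prob_space_laplace prob_space_return \<tau> simp: AE_return\<close>)
  then have "AE \<theta> in Gamma_prior p \<tau> S. \<forall>j\<in>{1..p} - S. \<theta> j = 0"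
    by (intro AE_finite_allI) auto
  then show ?thesis
    using AE_space by eventually_elim (auto simp: Theta_def)
qed

end

section \<open>Error probabilities of the test\<close>

lemma nn_integral_unit_gauss:
  assumes [measurable]: "f \<in> borel_measurable (PiM {1..p} (\<lambda>_. borel))"
    and "\<And>Y. 0 \<le> f Y \<and> f Y \<le> (1::real)"
  shows "(\<integral>\<^sup>+Y. ennreal (f Y) \<partial>gauss p \<theta>) = ennreal (\<integral>Y. f Y \<partial>gauss p \<theta>)"
proof -
  interpret prob_space "gauss p \<theta>" by (rule prob_space_gauss)
  have "integrable (gauss p \<theta>) f"
    by (rule integrable_const_bound[where B = 1]) (use assms(2) in auto)
  then show ?thesis by (rule nn_integral_eq_integral) (use assms(2) in auto)
qed

definition sparse_test :: "nat \<Rightarrow> real \<Rightarrow> (nat \<Rightarrow> real) \<Rightarrow> (nat \<Rightarrow> real) \<Rightarrow> real" where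
  "sparse_test p r t Y = min 1 (test_stat p r t Y)"

lemma sparse_test_measurable[measurable]: "sparse_test p r t \<in> borel_measurable (PiM {1..p} (\<lambda>_. borel))"
  unfolding sparse_test_def[abs_def] by measurable

lemma sparse_test_bounds: "0 \<le> sparse_test p r t Y \<and> sparse_test p r t Y \<le> 1"
  using test_stat_pos[of p r t Y] by (auto simp: sparse_test_def)

lemma half_le_ln:
  assumes "(p::nat) \<ge> 2"
  shows "1 / 2 \<le> ln (real p)"
proof -
  have "ln 2 \<le> ln (real p)" using assms by simp
  then show ?thesis using ln2_ge_two_thirds by linarith
qed

lemma integral_sparse_test_le:
  fixes s :: nat
  assumes "p \<ge> 2"
  defines "r \<equiv> real s * ln (real p)"
  shows "(\<integral>Y. sparse_test p r t Y \<partial>gauss p t) \<le> exp (- r)"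
\<comment> \<open>For \<open>s = 0\<close> the moment bound is only e, so the trivial bound
  \<open>exp 0\<close> is used; otherwise \<open>r \<ge> 1 / 2\<close> absorbs the 1 in
  \<open>1 - 3 * r\<close>.\<close>
proof (cases "s = 0")
  case True
  interpret prob_space "gauss p t" by (rule prob_space_gauss)
  have "(\<integral>Y. sparse_test p r t Y \<partial>gauss p t) \<le> 1"
    by (rule integral_le_const)
      (use sparse_test_bounds in \<open>auto intro!: integrable_const_bound[where B = 1]\<close>)
  then show ?thesis using True by (simp add: r_def)
next
  case False
  then have "1 * (1 / 2) \<le> r" unfolding r_def
    using half_le_ln[OF assms(1)] by (intro mult_mono) auto
  then have r: "1 - 3 * r \<le> - r" by simp
  have "ennreal (\<integral>Y. sparse_test p r t Y \<partial>gauss p t) = (\<integral>\<^sup>+Y. ennreal (sparse_test p r t Y) \<partial>gauss p t)"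
    by (rule nn_integral_unit_gauss[symmetric]) (auto simp: sparse_test_bounds)
  also have "\<dots> \<le> (\<integral>\<^sup>+Y. ennreal (test_stat p r t Y) \<partial>gauss p t)"
    by (intro nn_integral_mono ennreal_leI) (simp add: sparse_test_def)
  also have "\<dots> \<le> ennreal (exp (1 - 3 * r))"
    by (rule nn_integral_test_stat) fact
  also have "\<dots> \<le> ennreal (exp (- r))" using r by (intro ennreal_leI) simp
  finally show ?thesis by (simp add: ennreal_le_iff)
qed

lemma nn_integral_one_minus_sparse_test_le:
  assumes "p \<ge> 2" "S \<subseteq> {1..p}" "T \<subseteq> {1..p}" "u \<in> Theta p S" "t \<in> Theta p T"
  defines "r \<equiv> real (card T) * ln (real p)"
  shows "(\<integral>\<^sup>+Y. ennreal (1 - sparse_test p r t Y) \<partial>gauss p u) \<le>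
    ennreal (exp (3 * real (card S) * ln (real p) + 6 * r - sq_dist p u t / 6))"
proof -
  have "(\<integral>\<^sup>+Y. ennreal (1 - sparse_test p r t Y) \<partial>gauss p u) \<le> (\<integral>\<^sup>+Y. ennreal (1 / test_stat p r t Y) \<partial>gauss p u)"
  proof (intro nn_integral_mono ennreal_leI)
    fix Y
    \<comment> \<open>Where the statistic is at least 1 the left side is 0; elsewhere the right side
      exceeds 1.\<close>
    show "1 - sparse_test p r t Y \<le> 1 / test_stat p r t Y"
      using test_stat_pos[of p r t Y] sparse_test_bounds[of p r t Y]
      by (cases "test_stat p r t Y \<le> 1") (auto simp: sparse_test_def min_def le_divide_eq_1 intro: order_trans[of _ 1])
  qed
  also have "\<dots> \<le> ennreal (exp (3 * r + 3 * ln (real p) * real (card (S \<union> T)) - sq_dist p u t / 6))"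
    by (rule nn_integral_inverse_test_stat) fact+
  also have "\<dots> \<le> ennreal (exp (3 * real (card S) * ln (real p) + 6 * r - sq_dist p u t / 6))"
  proof (intro ennreal_leI)
    have "real (card (S \<union> T)) \<le> real (card S + card T)" by (intro of_nat_mono card_Un_le)
    then have "(3 * ln (real p)) * real (card (S \<union> T)) \<le> (3 * ln (real p)) * real (card S + card T)"
      using assms(1) by (intro mult_left_mono) auto
    then show "exp (3 * r + 3 * ln (real p) * real (card (S \<union> T)) - sq_dist p u t / 6) \<le>
      exp (3 * real (card S) * ln (real p) + 6 * r - sq_dist p u t / 6)"
      by (simp add: r_def algebra_simps)
  qed
  finally show ?thesis .
qed

section \<open>Slab masses relative to the ball around the truth\<close>

text \<open>Serves as \<open>C2\<close>. The 6 pays for the test, whose error exponent has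
  coefficients 3 and 6; the rest pays for prior mass, doubled because a cost per coordinate becomes
  a multiple of \<open>ln p\<close> through \<open>1 \<le> 2 * ln p\<close>.\<close>

definition complexity_const :: "real \<Rightarrow> real" where
  "complexity_const \<tau> = 6 + 2 * (slab_upper_const \<tau> + slab_lower_const \<tau>)"

text \<open>Stated as a product rather than a quotient, for use under \<open>ennreal\<close>. The 6
  withheld from the constant is reserved for the error of the test.\<close>

lemma bump_ratio:
  assumes "\<tau> > 0" "p \<ge> 2" "S \<subseteq> {1..p}" "T \<subseteq> {1..p}" "t \<in> Theta p T"
  defines "r \<equiv> real (card T) * ln (real p)"
  shows "(\<integral>\<^sup>+\<theta>. ennreal (exp (- sq_dist p \<theta> t / 16)) \<partial>Gamma_prior p \<tau> S) \<le>
    ennreal (exp ((complexity_const \<tau> - 6) * (real (card S) * ln (real p) + r))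
      * measure (Gamma_prior p \<tau> T) (theta_ball p t T r))"
    and "0 < measure (Gamma_prior p \<tau> T) (theta_ball p t T r)"
proof -
  interpret T: prob_space "Gamma_prior p \<tau> T" by (rule prob_space_Gamma_prior) fact
  let ?D = "measure (Gamma_prior p \<tau> T) (theta_ball p t T r)"
  define l where "l = exp (- slab_lower_const \<tau> * real (card T) - \<tau> * (\<Sum>j\<in>{1..p}. \<bar>t j\<bar>))"
  have "ennreal l \<le> ennreal ?D"
    using emeasure_theta_ball_ge[OF assms(1,2,4,5)] by (simp add: T.emeasure_eq_measure r_def l_def)
  then have l: "l \<le> ?D" by (simp add: ennreal_le_iff)
  moreover have "l > 0" by (simp add: l_def)
  ultimately show "0 < ?D" by linarith
  have "(\<integral>\<^sup>+\<theta>. ennreal (exp (- sq_dist p \<theta> t / 16)) \<partial>Gamma_prior p \<tau> S) \<le>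
      ennreal (exp (slab_upper_const \<tau> * real (card (S \<union> T)) - \<tau> * (\<Sum>j\<in>{1..p}. \<bar>t j\<bar>)))"
    by (rule nn_integral_Gamma_prior_bump_le) fact+
  also have "\<dots> \<le> ennreal (exp ((complexity_const \<tau> - 6) * (real (card S) * ln (real p) + r)) * ?D)"
  proof (rule ennreal_leI)
    note u = slab_upper_const_nonneg[OF assms(1)] and lo = slab_lower_const_nonneg[OF assms(1)]
    have "real (card (S \<union> T)) \<le> real (card S + card T)" by (intro of_nat_mono card_Un_le)
    then have 1: "slab_upper_const \<tau> * real (card (S \<union> T)) \<le> slab_upper_const \<tau> * real (card S + card T)"
      using u by (rule mult_left_mono)
    have 2: "slab_lower_const \<tau> * real (card T) \<le> slab_lower_const \<tau> * real (card S + card T)"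
      using lo by (intro mult_left_mono) auto
    have "1 * real (card S + card T) \<le> (2 * ln (real p)) * real (card S + card T)"
      using half_le_ln[OF assms(2)] by (intro mult_right_mono) auto
    then have "(slab_upper_const \<tau> + slab_lower_const \<tau>) * real (card S + card T) \<le>
        (slab_upper_const \<tau> + slab_lower_const \<tau>) * ((2 * ln (real p)) * real (card S + card T))"
      using u lo by (intro mult_left_mono) auto
    also have "\<dots> = (complexity_const \<tau> - 6) * (real (card S) * ln (real p) + r)"
      by (simp add: complexity_const_def r_def algebra_simps)
    finally have "slab_upper_const \<tau> * real (card (S \<union> T)) - \<tau> * (\<Sum>j\<in>{1..p}. \<bar>t j\<bar>) \<le>
       (complexity_const \<tau> - 6) * (real (card S) * ln (real p) + r)
        + (- slab_lower_const \<tau> * real (card T) - \<tau> * (\<Sum>j\<in>{1..p}. \<bar>t j\<bar>))"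
      using 1 2 by (simp add: distrib_right)
    then have "exp (slab_upper_const \<tau> * real (card (S \<union> T)) - \<tau> * (\<Sum>j\<in>{1..p}. \<bar>t j\<bar>)) \<le>
       exp ((complexity_const \<tau> - 6) * (real (card S) * ln (real p) + r)) * l"
      unfolding l_def exp_add[symmetric] by simp
    also have "\<dots> \<le> exp ((complexity_const \<tau> - 6) * (real (card S) * ln (real p) + r)) * ?D"
      using l by simp
    finally show "exp (slab_upper_const \<tau> * real (card (S \<union> T)) - \<tau> * (\<Sum>j\<in>{1..p}. \<bar>t j\<bar>)) \<le>
      exp ((complexity_const \<tau> - 6) * (real (card S) * ln (real p) + r)) * ?D" .
  qed
  finally show "(\<integral>\<^sup>+\<theta>. ennreal (exp (- sq_dist p \<theta> t / 16)) \<partial>Gamma_prior p \<tau> S) \<le>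
    ennreal (exp ((complexity_const \<tau> - 6) * (real (card S) * ln (real p) + r)) * ?D)" .
qed

text \<open>A Chernoff bound: inside the ball \<open>exp (e / 16)\<close> times the bump is at least
  1. This is the source of \<open>C5 = 1/16\<close>.\<close>

lemma ball_ratio:
  assumes "\<tau> > 0" "p \<ge> 2" "S \<subseteq> {1..p}" "T \<subseteq> {1..p}" "t \<in> Theta p T"
  defines "r \<equiv> real (card T) * ln (real p)"
  shows "measure (Gamma_prior p \<tau> S) {\<theta> \<in> Theta p S. sq_dist p \<theta> t \<le> e} \<le>
    exp (e / 16 + (complexity_const \<tau> - 6) * (real (card S) * ln (real p) + r))
      * measure (Gamma_prior p \<tau> T) (theta_ball p t T r)"
proof -
  interpret S: prob_space "Gamma_prior p \<tau> S" by (rule prob_space_Gamma_prior) fact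
  let ?D = "measure (Gamma_prior p \<tau> T) (theta_ball p t T r)"
  let ?N = "{\<theta> \<in> Theta p S. sq_dist p \<theta> t \<le> e}"
  have "?N = theta_ball p t S (e / 2)" by (auto simp: theta_ball_def)
  then have N[measurable]: "?N \<in> sets (PiM {1..p} (\<lambda>_. borel))" by simp
  have "emeasure (Gamma_prior p \<tau> S) ?N = (\<integral>\<^sup>+\<theta>. indicator ?N \<theta> \<partial>Gamma_prior p \<tau> S)" by simp
  also have "\<dots> \<le> (\<integral>\<^sup>+\<theta>. ennreal (exp (e / 16)) * ennreal (exp (- sq_dist p \<theta> t / 16)) \<partial>Gamma_prior p \<tau> S)"
  proof (rule nn_integral_mono)
    fix \<theta>
    show "indicator ?N \<theta> \<le> ennreal (exp (e / 16)) * ennreal (exp (- sq_dist p \<theta> t / 16))"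
    proof (cases "\<theta> \<in> ?N")
      case True
      then have "1 \<le> exp (e / 16 + - sq_dist p \<theta> t / 16)" by simp
      then have "ennreal 1 \<le> ennreal (exp (e / 16) * exp (- sq_dist p \<theta> t / 16))"
        unfolding exp_add by (rule ennreal_leI)
      then show ?thesis using True by (simp add: ennreal_mult')
    qed simp
  qed
  also have "\<dots> = ennreal (exp (e / 16)) * (\<integral>\<^sup>+\<theta>. ennreal (exp (- sq_dist p \<theta> t / 16)) \<partial>Gamma_prior p \<tau> S)"
    by (rule nn_integral_cmult) measurable
  also have "\<dots> \<le> ennreal (exp (e / 16)) * ennreal (exp ((complexity_const \<tau> - 6) * (real (card S) * ln (real p) + r)) * ?D)"
    unfolding r_def by (intro mult_left_mono bump_ratio) (use assms in auto)
  also have "\<dots> = ennreal (exp (e / 16 + (complexity_const \<tau> - 6) * (real (card S) * ln (real p) + r)) * ?D)"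
    by (subst ennreal_mult'[symmetric]) (simp_all add: exp_add)
  finally show ?thesis by (simp add: S.emeasure_eq_measure ennreal_le_iff)
qed

section \<open>Beta kernels near their maximum\<close>

text \<open>This is \<open>ln z \<le> z - 1\<close> at \<open>z = x / y\<close>. The correction is
  linear in \<open>x\<close>, so the corrections for \<open>l\<close> and \<open>1 - l\<close> can
  cancel.\<close>

lemma pow0_le_exp:
  assumes "x \<ge> 0" "y > 0" "c \<ge> 0"
  shows "pow0 x c \<le> pow0 y c * exp (c * (x / y - 1))"
proof (cases "x = 0 \<or> c = 0")
  case True
  then show ?thesis using assms by (auto simp: pow0_def)
next
  case False
  then have x: "x > 0" "c \<noteq> 0" using assms by auto
  have "ln (x / y) \<le> x / y - 1" using x assms by (intro ln_le_minus_one) simp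
  then have "c * ln x \<le> c * (ln y + (x / y - 1))" using x assms by (intro mult_left_mono) (auto simp: ln_div)
  then show ?thesis using x assms by (simp add: pow0_def powr_def distrib_left flip: exp_add)
qed

lemma pow0_pos: "x > 0 \<Longrightarrow> pow0 x c > 0"
  by (simp add: pow0_def)

lemma pow0_nonneg: "x \<ge> 0 \<Longrightarrow> pow0 x c \<ge> 0"
  by (simp add: pow0_def)

lemma pow0_add_nat:
  assumes "x \<ge> 0" "c \<ge> 0"
  shows "pow0 x (c + real n) = pow0 x c * x ^ n"
proof (cases "x = 0 \<or> n = 0")
  case True
  then show ?thesis using assms by (auto simp: pow0_def)
next
  case False
  then show ?thesis using assms by (auto simp: pow0_def powr_add powr_realpow)
qed

text \<open>Conjugacy: weight times binomial factor is again a beta kernel, and \<open>pow0\<close>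
  keeps this true at the end points, where an exponent may be 0.\<close>

lemma weight_nu_eq:
  assumes "\<alpha> \<ge> 1" "\<beta> \<ge> 1" "card S \<le> p" "l \<in> {0..1}"
  shows "beta_weight \<alpha> \<beta> l * nu p l S =
    pow0 l (\<alpha> - 1 + real (card S)) * pow0 (1 - l) (\<beta> - 1 + real p - real (card S))"
proof -
  have "pow0 (1 - l) (\<beta> - 1 + real p - real (card S)) = pow0 (1 - l) (\<beta> - 1 + real (p - card S))"
    using assms(3) by (simp add: of_nat_diff add_diff_eq)
  then show ?thesis using assms
    by (simp add: beta_weight_def nu_def pow0_add_nat del: of_nat_diff)
qed

text \<open>Isolates the dependence on the set size in a power of the odds and leaves a kernel
  common to all sets.\<close>

lemma pow0_odds:
  assumes "0 < l" "l < 1" "a \<ge> 0" "B \<ge> real s"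
  shows "pow0 l (a + real s) * pow0 (1 - l) (B - real s) = (l / (1 - l)) ^ s * (pow0 l a * pow0 (1 - l) B)"
proof -
  have "pow0 (1 - l) B = pow0 (1 - l) (B - real s) * (1 - l) ^ s"
    using pow0_add_nat[of "1 - l" "B - real s" s] assms by simp
  then show ?thesis using assms by (simp add: pow0_add_nat power_divide)
qed

text \<open>The numerator \<open>a + 1\<close> keeps the comparison point positive for
  \<open>a = 0\<close>, where the true maximiser is 0. The corrections then sum to at most 1, hence
  the factor e.\<close>

lemma beta_kernel_le:
  assumes "a \<ge> 0" "B > 0" "l \<in> {0..1}"
  shows "pow0 l a * pow0 (1 - l) B \<le>
    exp 1 * (pow0 ((a + 1) / (a + B + 1)) a * pow0 (1 - (a + 1) / (a + B + 1)) B)"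
proof -
  let ?m = "(a + 1) / (a + B + 1)"
  have m: "?m > 0" "1 - ?m = B / (a + B + 1)" "1 - ?m > 0" using assms by (simp_all add: field_simps)
  have "a * (l / ?m) = a / (a + 1) * (l * (a + B + 1))" using assms by simp
  also have "\<dots> \<le> 1 * (l * (a + B + 1))" using assms by (intro mult_right_mono) auto
  finally have 1: "a * (l / ?m) \<le> l * (a + B + 1)" by simp
  have 2: "B * ((1 - l) / (1 - ?m)) = (1 - l) * (a + B + 1)" unfolding m(2) using assms by simp
  have "pow0 l a * pow0 (1 - l) B \<le>
    (pow0 ?m a * exp (a * (l / ?m - 1))) * (pow0 (1 - ?m) B * exp (B * ((1 - l) / (1 - ?m) - 1)))"
    using assms m by (intro mult_mono pow0_le_exp mult_nonneg_nonneg pow0_nonneg) auto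
  also have "\<dots> = exp (a * (l / ?m - 1) + B * ((1 - l) / (1 - ?m) - 1)) * (pow0 ?m a * pow0 (1 - ?m) B)"
    by (simp add: exp_add)
  also have "\<dots> \<le> exp 1 * (pow0 ?m a * pow0 (1 - ?m) B)"
  proof (intro mult_right_mono)
    have "a * (l / ?m - 1) + B * ((1 - l) / (1 - ?m) - 1) = a * (l / ?m) + B * ((1 - l) / (1 - ?m)) - (a + B)"
      by (simp only: right_diff_distrib mult_1_right)
    also have "\<dots> \<le> l * (a + B + 1) + (1 - l) * (a + B + 1) - (a + B)"
      using 1 2 by linarith
    also have "\<dots> = 1" by (simp add: algebra_simps)
    finally show "exp (a * (l / ?m - 1) + B * ((1 - l) / (1 - ?m) - 1)) \<le> exp 1" by simp
  qed (use m in \<open>auto intro!: mult_nonneg_nonneg pow0_nonneg\<close>)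
  finally show ?thesis .
qed

text \<open>At the true maximiser the two corrections cancel exactly. It is applied to nonempty
  sets, whose exponent is positive.\<close>

lemma beta_kernel_max:
  assumes "a > 0" "B > 0" "l \<in> {0..1}"
  shows "pow0 l a * pow0 (1 - l) B \<le> pow0 (a / (a + B)) a * pow0 (1 - a / (a + B)) B"
proof -
  let ?m = "a / (a + B)"
  have m: "?m > 0" "1 - ?m = B / (a + B)" "1 - ?m > 0" using assms by (simp_all add: field_simps)
  have 1: "a * (l / ?m) = l * (a + B)" "B * ((1 - l) / (1 - ?m)) = (1 - l) * (a + B)"
    unfolding m(2) using assms by simp_all
  have "pow0 l a * pow0 (1 - l) B \<le>
    (pow0 ?m a * exp (a * (l / ?m - 1))) * (pow0 (1 - ?m) B * exp (B * ((1 - l) / (1 - ?m) - 1)))"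
    using assms m by (intro mult_mono pow0_le_exp mult_nonneg_nonneg pow0_nonneg) auto
  also have "\<dots> = exp (a * (l / ?m - 1) + B * ((1 - l) / (1 - ?m) - 1)) * (pow0 ?m a * pow0 (1 - ?m) B)"
    by (simp add: exp_add)
  also have "a * (l / ?m - 1) + B * ((1 - l) / (1 - ?m) - 1) = 0"
    by (simp only: right_diff_distrib mult_1_right 1) (simp add: algebra_simps)
  finally show ?thesis by simp
qed

subsection \<open>The effective weights\<close>

lemma sum_Pow_power_card:
  fixes x :: "'a :: comm_semiring_1"
  assumes "finite A"
  shows "(\<Sum>S\<in>Pow A. x ^ card S) = (1 + x) ^ card A"
  using prod_add[OF assms, of "\<lambda>_. x" "\<lambda>_. 1"] by (simp add: add.commute)

text \<open>Relative to the kernel at \<open>m\<close>, the effective weight of \<open>S\<close> is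
  at most e times \<open>q ^ card S\<close> with q = p^(2 - C2'), while \<open>T\<close> keeps at
  least the power -(C1' + 1) of p per element. The sum over \<open>S\<close> is a binomial expansion
  bounded by a second e; the two factors e are the 2 in the exponent.\<close>

lemma eff_weight_sum:
  fixes p :: nat and \<alpha> \<beta> C2 C1' C2' :: real and T :: "nat set"
  assumes p: "p \<ge> 2" and \<alpha>: "\<alpha> \<ge> 1" and up: "real p powr C1' \<ge> \<beta> / \<alpha>" and low: "\<beta> / \<alpha> \<ge> real p powr C2'"
    and C: "C2' \<ge> 2 * C2 + 3" "C2 \<ge> 0" "C1' \<ge> 1" and T: "T \<subseteq> {1..p}"
  defines "m \<equiv> \<alpha> / (\<alpha> + \<beta> - 1 + real p)" and "w \<equiv> beta_weight \<alpha> \<beta>"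
  shows "m \<in> {0..1}" "w m * nu p m T > 0"
    "(\<Sum>S\<in>Pow {1..p}. eff_weight p w S / (w m * nu p m T) * exp (2 * C2 * real (card S) * ln (real p)))
      \<le> exp (2 + (C1' + 1) * (real (card T) * ln (real p)))"
proof -
  define a B where "a = \<alpha> - 1" and "B = \<beta> - 1 + real p"
  have p2: "real p \<ge> 2" using p by simp
  have "real p powr 1 \<le> real p powr C2'" using C p2 by (intro powr_mono) auto
  then have "real p \<le> \<beta> / \<alpha>" using low p2 by simp
  then have "real p * \<alpha> \<le> \<beta>" using \<alpha> by (simp add: field_simps)
  moreover have "2 * 1 \<le> real p * \<alpha>" using p2 \<alpha> by (intro mult_mono) auto
  \<comment> \<open>This gives \<open>\<beta> - 1 \<ge> \<beta> / 2\<close>, so the exponent of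
    \<open>1 - l\<close> stays at least \<open>\<beta> / 2\<close> even for
    \<open>card S = p\<close>.\<close>
  ultimately have \<beta>: "\<beta> \<ge> 2" by simp
  have aB: "a \<ge> 0" "B > 0" "B \<ge> real p + \<beta> / 2" using \<alpha> \<beta> p2 by (auto simp: a_def B_def)
  have m_eq: "m = (a + 1) / (a + B + 1)" by (simp add: m_def a_def B_def algebra_simps)
  have m: "0 < m" "m < 1" "1 - m = B / (a + B + 1)"
    using aB unfolding m_eq by (simp_all add: field_simps)
  then show "m \<in> {0..1}" by simp
  define G where "G l = pow0 l a * pow0 (1 - l) B" for l
  have Gm: "G m > 0" using m by (simp add: G_def pow0_pos)
  have wnu: "w l * nu p l S = pow0 l (a + real (card S)) * pow0 (1 - l) (B - real (card S))"
    if "S \<subseteq> {1..p}" "l \<in> {0..1}" for l S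
  proof -
    have "card S \<le> p" using card_mono[OF _ that(1)] by simp
    then show ?thesis using weight_nu_eq[of \<alpha> \<beta> S p l] that \<alpha> \<beta> by (simp add: w_def a_def B_def)
  qed
  have cardp: "real (card S) \<le> real p" if "S \<subseteq> {1..p}" for S
    using card_mono[OF _ that] by simp
  have odds: "w l * nu p l S = (l / (1 - l)) ^ card S * G l" if "S \<subseteq> {1..p}" "0 < l" "l < 1" for l S
    using that aB cardp[OF that(1)] \<beta> by (simp add: wnu G_def pow0_odds)
  have T_eq: "w m * nu p m T = (m / (1 - m)) ^ card T * G m"
    by (rule odds) (use m T in auto)
  moreover have "m / (1 - m) > 0" using m(1,2) by simp
  ultimately show "w m * nu p m T > 0" using Gm by (simp only: mult_pos_pos zero_less_power)
  define q where "q = exp ((2 - C2') * ln (real p))"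
  have q0: "q > 0" by (simp add: q_def)
  have q_eq: "q = real p ^ 2 / real p powr C2'"
    using p2 by (simp add: q_def left_diff_distrib exp_diff powr_def exp_of_nat_mult[of 2 "ln (real p)", simplified])
  have kernel: "w l * nu p l S \<le> exp 1 * q ^ card S * G m" if S: "S \<subseteq> {1..p}" and l: "l \<in> {0..1}" for l S
  \<comment> \<open>For the empty set the exponent \<open>a\<close> may be 0, where
    \<open>beta_kernel_max\<close> does not apply; the shifted bound serves instead.\<close>
  proof (cases "card S = 0")
    case True
    then show ?thesis
      using beta_kernel_le[of a B l] aB l S by (simp add: wnu m_eq G_def)
  next
    case False
    let ?s = "real (card S)"
    let ?l = "(a + ?s) / (a + B)"
    have s: "1 \<le> ?s" "?s \<le> real p" using False cardp[OF S] by auto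
    have pos: "a + ?s > 0" "B - ?s > 0" "B - ?s \<ge> \<beta> / 2" using s aB \<beta> by auto
    have l': "0 < ?l" "?l < 1" "1 - ?l = (B - ?s) / (a + B)" using pos aB by (simp_all add: field_simps)
    \<comment> \<open>\<open>l\<close> moves to the maximiser for this \<open>S\<close>, whose odds
      are explicit; the kernel left there is then compared with the one at \<open>m\<close>.\<close>
    have "w l * nu p l S \<le> w ?l * nu p ?l S"
      using beta_kernel_max[of "a + ?s" "B - ?s" l] pos l l' by (simp add: wnu[OF S])
    also have "\<dots> = (?l / (1 - ?l)) ^ card S * G ?l" by (rule odds) (use S l' in auto)
    also have "?l / (1 - ?l) = (a + ?s) / (B - ?s)" unfolding l'(3) using aB by simp
    also have "((a + ?s) / (B - ?s)) ^ card S * G ?l \<le> q ^ card S * (exp 1 * G m)"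
    proof (intro mult_mono power_mono)
      have "0 \<le> (\<alpha> - 1) * (?s - 1)" using \<alpha> s by simp
      then have "a + ?s \<le> \<alpha> * ?s" by (simp add: a_def algebra_simps)
      also have "\<dots> \<le> \<alpha> * real p" using \<alpha> s by simp
      finally have "(a + ?s) / (B - ?s) \<le> (\<alpha> * real p) / (\<beta> / 2)"
        using pos \<beta> \<alpha> by (intro frac_le) auto
      also have "\<dots> = 2 * real p / (\<beta> / \<alpha>)" using \<alpha> by simp
      \<comment> \<open>The factor 2 is bounded by p, which explains the p^2 in
        \<open>q\<close>.\<close>
      also have "\<dots> \<le> real p * real p / (real p powr C2')"
        using p2 low \<beta> \<alpha> by (intro frac_le mult_right_mono) auto
      finally show "(a + ?s) / (B - ?s) \<le> q" unfolding q_eq by (simp add: power2_eq_square)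
      show "G ?l \<le> exp 1 * G m"
        using beta_kernel_le[of a B ?l] aB l' by (simp add: m_eq G_def)
    qed (use pos q0 l' in \<open>auto simp: G_def intro!: mult_nonneg_nonneg pow0_nonneg\<close>)
    finally show ?thesis by (simp add: mult_ac)
  qed
  have eff: "eff_weight p w S \<le> exp 1 * q ^ card S * G m" if "S \<subseteq> {1..p}" for S
    unfolding eff_weight_def by (rule cSUP_least) (use kernel that in auto)
  \<comment> \<open>The odds at \<open>m\<close> are \<open>\<alpha> / B\<close>, and
    \<open>B / \<alpha>\<close> is at most \<open>2 * p powr C1'\<close>; bounding 2 by p gives the
    exponent \<open>C1' + 1\<close>.\<close>
  have om: "exp (- (C1' + 1) * ln (real p)) \<le> m / (1 - m)"
  proof -
    have 1: "m / (1 - m) = \<alpha> / B" unfolding m(3) unfolding m_eq using aB by (simp add: a_def)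
    have "B \<le> \<beta> + \<alpha> * real p" using mult_right_mono[OF \<alpha>, of "real p"] by (simp add: B_def)
    then have "B / \<alpha> \<le> \<beta> / \<alpha> + real p" using \<alpha> by (simp add: field_simps)
    also have "\<dots> \<le> real p powr C1' + real p powr C1'"
      using up powr_mono[of 1 C1' "real p"] C p2 by simp
    also have "\<dots> \<le> real p * real p powr C1'" using p2 by simp
    also have "\<dots> = exp ((C1' + 1) * ln (real p))" using p2 by (simp add: powr_def distrib_right exp_add)
    finally have "1 / exp ((C1' + 1) * ln (real p)) \<le> 1 / (B / \<alpha>)"
      using aB \<alpha> by (intro divide_left_mono) auto
    moreover have "exp (- (C1' + 1) * ln (real p)) = 1 / exp ((C1' + 1) * ln (real p))"
      unfolding mult_minus_left by (simp only: exp_minus inverse_eq_divide)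
    ultimately show ?thesis unfolding 1 by simp
  qed
  define Q where "Q = exp ((C1' + 1) * (real (card T) * ln (real p)))"
  have den: "G m \<le> Q * (w m * nu p m T)"
  proof -
    have "1 / Q = exp (- (C1' + 1) * ln (real p)) ^ card T"
      by (simp add: Q_def exp_of_nat_mult[symmetric] exp_minus[symmetric] inverse_eq_divide[symmetric] algebra_simps)
    also have "\<dots> \<le> (m / (1 - m)) ^ card T" by (intro power_mono om) simp
    finally have "1 / Q * G m \<le> w m * nu p m T" unfolding T_eq using Gm by (intro mult_right_mono) auto
    then show ?thesis by (simp add: Q_def field_simps)
  qed
  define y where "y = q * exp (2 * C2 * ln (real p))"
  have y0: "y \<ge> 0" by (simp add: y_def q_def)
  \<comment> \<open>The exponent of p is \<open>2 - C2' + 2 * C2\<close>, at most -1 because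
    \<open>C2' \<ge> 2 * C2 + 3\<close>.\<close>
  have "y \<le> exp (- 1 * ln (real p))"
    unfolding y_def q_def exp_add[symmetric] distrib_right[symmetric]
    using C p2 by (subst exp_le_cancel_iff, intro mult_right_mono) auto
  then have y1: "y \<le> 1 / real p" using p2 by (simp add: exp_minus inverse_eq_divide)
  have "(\<Sum>S\<in>Pow {1..p}. eff_weight p w S / (w m * nu p m T) * exp (2 * C2 * real (card S) * ln (real p)))
      \<le> (\<Sum>S\<in>Pow {1..p}. exp 1 * Q * y ^ card S)"
  proof (rule sum_mono)
    fix S assume "S \<in> Pow {1..p}"
    then have S: "S \<subseteq> {1..p}" by simp
    have "eff_weight p w S \<le> exp 1 * q ^ card S * G m" by (rule eff) fact
    also have "\<dots> \<le> exp 1 * q ^ card S * (Q * (w m * nu p m T))"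
      using q0 by (intro mult_left_mono den) auto
    finally have "eff_weight p w S / (w m * nu p m T) \<le> exp 1 * q ^ card S * Q"
      using \<open>w m * nu p m T > 0\<close> by (simp add: field_simps)
    then have *: "eff_weight p w S / (w m * nu p m T) * exp (2 * C2 * ln (real p)) ^ card S \<le>
      exp 1 * q ^ card S * Q * exp (2 * C2 * ln (real p)) ^ card S"
      by (rule mult_right_mono) simp
    have e: "exp (2 * C2 * real (card S) * ln (real p)) = exp (2 * C2 * ln (real p)) ^ card S"
      by (simp add: exp_of_nat_mult[symmetric] mult_ac)
    show "eff_weight p w S / (w m * nu p m T) * exp (2 * C2 * real (card S) * ln (real p)) \<le> exp 1 * Q * y ^ card S"
      using * unfolding e y_def power_mult_distrib by (simp only: mult_ac)
  qed
  also have "\<dots> = exp 1 * Q * (1 + y) ^ p"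
    by (simp add: sum_distrib_left[symmetric] sum_Pow_power_card)
  also have "\<dots> \<le> exp 1 * Q * exp 1"
  proof (rule mult_left_mono)
    have "(1 + y) ^ p \<le> exp (1 / real p) ^ p"
      using y0 y1 exp_ge_add_one_self[of "1 / real p"] by (intro power_mono) linarith+
    also have "\<dots> = exp 1" using p2 by (simp add: exp_of_nat_mult[symmetric])
    finally show "(1 + y) ^ p \<le> exp 1" .
  qed (simp add: Q_def)
  also have "\<dots> = exp (2 + (C1' + 1) * (real (card T) * ln (real p)))"
    by (simp add: Q_def exp_add[symmetric])
  finally show "(\<Sum>S\<in>Pow {1..p}. eff_weight p w S / (w m * nu p m T) * exp (2 * C2 * real (card S) * ln (real p)))
      \<le> exp (2 + (C1' + 1) * (real (card T) * ln (real p)))" .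
qed

subsection \<open>The empirical Bayes posterior\<close>

definition slab_marginal :: "nat \<Rightarrow> real \<Rightarrow> nat set \<Rightarrow> (nat \<Rightarrow> real) set \<Rightarrow> (nat \<Rightarrow> real) \<Rightarrow> ennreal" where
  "slab_marginal p \<tau> S A Y = (\<integral>\<^sup>+\<theta>. ennreal (likelihood p \<theta> Y) * indicator A \<theta> \<partial>Gamma_prior p \<tau> S)"

lemma slab_marginal_le_1:
  assumes "\<tau> > 0"
  shows "slab_marginal p \<tau> S A Y \<le> 1"
proof -
  interpret prob_space "Gamma_prior p \<tau> S" by (rule prob_space_Gamma_prior) fact
  have "slab_marginal p \<tau> S A Y \<le> (\<integral>\<^sup>+\<theta>. 1 \<partial>Gamma_prior p \<tau> S)"
    unfolding slab_marginal_def
    using likelihood_le_1[of p _ Y] by (intro nn_integral_mono) (auto simp: indicator_def)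
  then show ?thesis using emeasure_space_1 by simp
qed

lemma nn_integral_spike_slab_likelihood:
  assumes "\<tau> > 0" "l \<in> {0..1}" and [measurable]: "A \<in> sets (PiM {1..p} (\<lambda>_. borel))"
  shows "(\<integral>\<^sup>+\<theta>. ennreal (likelihood p \<theta> Y) * indicator A \<theta> \<partial>spike_slab p \<tau> l) =
    (\<Sum>S\<in>Pow {1..p}. ennreal (nu p l S) * slab_marginal p \<tau> S A Y)"
  unfolding slab_marginal_def using assms(3) by (intro nn_integral_spike_slab assms(1,2)) measurable

lemma marginal_eq:
  assumes "\<tau> > 0" "l \<in> {0..1}"
  shows "marginal p \<tau> l Y = (\<Sum>S\<in>Pow {1..p}. ennreal (nu p l S) * slab_marginal p \<tau> S UNIV Y)"
  unfolding marginal_def slab_marginal_def using assms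
  by (simp only: indicator_UNIV mult_1_right) (intro nn_integral_spike_slab; measurable)

text \<open>In \<open>ennreal\<close> both 0 / 0 and \<open>top / top\<close> are 0, so the
  inequality covers all values of the evidence at once.\<close>

lemma ennreal_divide_self_le_1: "x / x \<le> (1::ennreal)"
  by (cases "x = 0 \<or> x = top") (auto simp: ennreal_divide_self less_top)

lemma emeasure_posterior:
  assumes A[measurable]: "A \<in> sets (PiM {1..p} (\<lambda>_. borel))"
  shows "emeasure (posterior p \<tau> l Y) A = (\<integral>\<^sup>+\<theta>. ennreal (likelihood p \<theta> Y) * indicator A \<theta> \<partial>spike_slab p \<tau> l) / marginal p \<tau> l Y"
    and "emeasure (posterior p \<tau> l Y) A \<le> 1"
proof -
  have "emeasure (posterior p \<tau> l Y) A = (\<integral>\<^sup>+\<theta>. (ennreal (likelihood p \<theta> Y) * indicator A \<theta>) / marginal p \<tau> l Y \<partial>spike_slab p \<tau> l)"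
    unfolding posterior_def
  proof (subst emeasure_density)
    have "a / m * i = a * i / m" for a m i :: ennreal
      unfolding divide_ennreal_def by (simp only: mult_ac)
    then show "(\<integral>\<^sup>+\<theta>. ennreal (likelihood p \<theta> Y) / marginal p \<tau> l Y * indicator A \<theta> \<partial>spike_slab p \<tau> l) =
      (\<integral>\<^sup>+\<theta>. (ennreal (likelihood p \<theta> Y) * indicator A \<theta>) / marginal p \<tau> l Y \<partial>spike_slab p \<tau> l)"
      by (simp only:)
  qed simp_all
  also have "\<dots> = (\<integral>\<^sup>+\<theta>. ennreal (likelihood p \<theta> Y) * indicator A \<theta> \<partial>spike_slab p \<tau> l) / marginal p \<tau> l Y"
    by (rule nn_integral_divide) measurable
  finally show eq: "emeasure (posterior p \<tau> l Y) A = (\<integral>\<^sup>+\<theta>. ennreal (likelihood p \<theta> Y) * indicator A \<theta> \<partial>spike_slab p \<tau> l) / marginal p \<tau> l Y" .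
  have "(\<integral>\<^sup>+\<theta>. ennreal (likelihood p \<theta> Y) * indicator A \<theta> \<partial>spike_slab p \<tau> l) \<le> marginal p \<tau> l Y"
    unfolding marginal_def by (intro nn_integral_mono) (auto simp: indicator_def)
  then have "emeasure (posterior p \<tau> l Y) A \<le> marginal p \<tau> l Y / marginal p \<tau> l Y"
    unfolding eq by (rule divide_right_mono_ennreal)
  also have "\<dots> \<le> 1" by (rule ennreal_divide_self_le_1)
  finally show "emeasure (posterior p \<tau> l Y) A \<le> 1" .
qed

lemma ext_ln_mono: "x \<le> y \<Longrightarrow> ext_ln x \<le> ext_ln y"
  by (cases x; cases y) (auto simp: ext_ln_def ennreal_eq_0_iff top_unique)

lemma ext_ln_strict_mono: "x < y \<Longrightarrow> ext_ln x < ext_ln y"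
  by (cases x; cases y) (auto simp: ext_ln_def ennreal_eq_0_iff ennreal_less_iff)

lemma continuous_on_beta_weight:
  assumes "\<alpha> \<ge> 1" "\<beta> \<ge> 1"
  shows "continuous_on {0..1} (beta_weight \<alpha> \<beta>)"
proof -
  have *: "continuous_on {0..1} (\<lambda>l. pow0 (f l) (a - 1))"
    if "a \<ge> 1" "continuous_on {0..1} f" "\<And>l. l \<in> {0..1} \<Longrightarrow> f l \<ge> 0"
    for a :: real and f :: "real \<Rightarrow> real"
  proof (cases "a = 1")
    case False
    have "continuous_on {0..1} (\<lambda>l. f l powr (a - 1))"
      by (rule continuous_on_powr') (use that False in auto)
    then show ?thesis using False by (simp add: pow0_def)
  qed (simp add: pow0_def)
  show ?thesis
    unfolding beta_weight_def[abs_def]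
    by (intro continuous_intros *) (use assms in \<open>auto intro!: continuous_intros\<close>)
qed

lemma beta_weight_nonneg: "l \<in> {0..1} \<Longrightarrow> beta_weight \<alpha> \<beta> l \<ge> 0"
  by (simp add: beta_weight_def pow0_nonneg)

lemma nu_nonneg: "l \<in> {0..1} \<Longrightarrow> nu p l S \<ge> 0"
  by (simp add: nu_def)

text \<open>\<open>arg_max_on\<close> is a choice operator and says something only once a maximiser
  exists. The evidence is a polynomial in \<open>l\<close> with finite coefficients and the weight
  is continuous on the closed interval, so one does; strict monotonicity of \<open>ext_ln\<close>
  then removes the logarithm.\<close>

lemma lam_hat_maximal:
  assumes \<tau>: "\<tau> > 0" and "\<alpha> \<ge> 1" "\<beta> \<ge> 1"
  defines "w \<equiv> beta_weight \<alpha> \<beta>"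
  shows "lam_hat p \<tau> w Y \<in> {0..1}"
    and "l \<in> {0..1} \<Longrightarrow> ennreal (w l) * marginal p \<tau> l Y \<le>
      ennreal (w (lam_hat p \<tau> w Y)) * marginal p \<tau> (lam_hat p \<tau> w Y) Y"
proof -
  define f where "f l = ext_ln (ennreal (w l) * marginal p \<tau> l Y)" for l
  define h where "h l = w l * (\<Sum>S\<in>Pow {1..p}. nu p l S * enn2real (slab_marginal p \<tau> S UNIV Y))" for l
  have h: "ennreal (w l) * marginal p \<tau> l Y = ennreal (h l)" if l: "l \<in> {0..1}" for l
  proof -
    have "slab_marginal p \<tau> S UNIV Y = ennreal (enn2real (slab_marginal p \<tau> S UNIV Y))" for S
      using slab_marginal_le_1[OF \<tau>, of p S UNIV Y] by (subst ennreal_enn2real) (auto simp: less_top[symmetric] top_unique)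
    then have "marginal p \<tau> l Y = (\<Sum>S\<in>Pow {1..p}. ennreal (nu p l S * enn2real (slab_marginal p \<tau> S UNIV Y)))"
      unfolding marginal_eq[OF \<tau> l] using nu_nonneg[OF l] by (intro sum.cong) (auto simp: ennreal_mult')
    also have "\<dots> = ennreal (\<Sum>S\<in>Pow {1..p}. nu p l S * enn2real (slab_marginal p \<tau> S UNIV Y))"
      using nu_nonneg[OF l] by (intro sum_ennreal) simp
    finally show ?thesis using beta_weight_nonneg[OF l] by (simp add: h_def w_def ennreal_mult')
  qed
  have "continuous_on {0..1} h"
    unfolding h_def nu_def w_def
    by (intro continuous_intros continuous_on_beta_weight assms)
  then obtain l0 where l0: "l0 \<in> {0..1}" "\<forall>l\<in>{0..1}. h l \<le> h l0"
    using continuous_attains_sup[of "{0..1::real}" h] by auto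
  have "is_arg_max f (\<lambda>l. l \<in> {0..1}) l0"
    unfolding is_arg_max_linorder f_def using l0 by (auto intro!: ext_ln_mono ennreal_leI simp: h)
  then have am: "is_arg_max f (\<lambda>l. l \<in> {0..1}) (lam_hat p \<tau> w Y)"
    unfolding lam_hat_def arg_max_on_def arg_max_def f_def[symmetric, abs_def] by (rule someI)
  then show "lam_hat p \<tau> w Y \<in> {0..1}" by (simp add: is_arg_max_def)
  show "ennreal (w l) * marginal p \<tau> l Y \<le>
      ennreal (w (lam_hat p \<tau> w Y)) * marginal p \<tau> (lam_hat p \<tau> w Y) Y" if "l \<in> {0..1}"
    using am that ext_ln_strict_mono unfolding is_arg_max_def f_def by (meson not_le)
qed

lemma weight_nu_le_eff_weight:
  assumes "\<alpha> \<ge> 1" "\<beta> \<ge> 1" "l \<in> {0..1}"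
  shows "beta_weight \<alpha> \<beta> l * nu p l S \<le> eff_weight p (beta_weight \<alpha> \<beta>) S"
  using eff_weight_attained[OF assms(1,2), of p S] assms(3) by force

text \<open>The factor \<open>w k\<close> multiplies numerator and evidence alike. In the evidence
  maximality swaps the data-dependent \<open>k\<close> for the fixed \<open>l\<close>; in the
  numerator \<open>w k * nu p k S\<close> is at most the effective weight.\<close>

lemma posterior_lam_hat_le:
  assumes \<tau>: "\<tau> > 0" and "\<alpha> \<ge> 1" "\<beta> \<ge> 1" and l: "l \<in> {0..1}" and T: "T \<subseteq> {1..p}"
    and A[measurable]: "A \<in> sets (PiM {1..p} (\<lambda>_. borel))"
  defines "w \<equiv> beta_weight \<alpha> \<beta>"
  shows "emeasure (posterior p \<tau> (lam_hat p \<tau> w Y) Y) A * (ennreal (w l * nu p l T) * slab_marginal p \<tau> T B Y) \<le>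
    (\<Sum>S\<in>Pow {1..p}. ennreal (eff_weight p w S) * slab_marginal p \<tau> S A Y)"
proof -
  define k where "k = lam_hat p \<tau> w Y"
  define E where "E = emeasure (posterior p \<tau> k Y) A"
  define x where "x = (\<integral>\<^sup>+\<theta>. ennreal (likelihood p \<theta> Y) * indicator A \<theta> \<partial>spike_slab p \<tau> k)"
  have k: "k \<in> {0..1}" unfolding k_def w_def by (rule lam_hat_maximal) fact+
  have "E * marginal p \<tau> k Y \<le> x"
  proof -
    have 1: "E = x / marginal p \<tau> k Y" unfolding E_def x_def by (rule emeasure_posterior) fact
    have "E * marginal p \<tau> k Y = x * (marginal p \<tau> k Y / marginal p \<tau> k Y)"
      unfolding 1 divide_ennreal_def by (simp only: mult_ac)
    also have "\<dots> \<le> x * 1" by (intro mult_left_mono ennreal_divide_self_le_1) simp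
    finally show ?thesis by simp
  qed
  \<comment> \<open>Of the evidence at \<open>l\<close> only the term of \<open>T\<close>,
    restricted to \<open>B\<close>, is kept.\<close>
  have "slab_marginal p \<tau> T B Y \<le> slab_marginal p \<tau> T UNIV Y"
    unfolding slab_marginal_def by (intro nn_integral_mono) (auto simp: indicator_def)
  then have "ennreal (nu p l T) * slab_marginal p \<tau> T B Y \<le> ennreal (nu p l T) * slab_marginal p \<tau> T UNIV Y"
    by (rule mult_left_mono) simp
  also have "\<dots> \<le> marginal p \<tau> l Y"
    unfolding marginal_eq[OF \<tau> l] using T
    by (intro member_le_sum) auto
  finally have "ennreal (w l * nu p l T) * slab_marginal p \<tau> T B Y \<le> ennreal (w l) * marginal p \<tau> l Y"
    using beta_weight_nonneg[OF l] by (simp add: w_def ennreal_mult' mult.assoc mult_left_mono)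
  also have "\<dots> \<le> ennreal (w k) * marginal p \<tau> k Y"
    unfolding k_def w_def by (rule lam_hat_maximal) fact+
  finally have "E * (ennreal (w l * nu p l T) * slab_marginal p \<tau> T B Y) \<le> E * (ennreal (w k) * marginal p \<tau> k Y)"
    by (rule mult_left_mono) simp
  also have "\<dots> = ennreal (w k) * (E * marginal p \<tau> k Y)" by (simp add: mult_ac)
  also have "\<dots> \<le> ennreal (w k) * x" by (rule mult_left_mono) (fact, simp)
  also have "x = (\<Sum>S\<in>Pow {1..p}. ennreal (nu p k S) * slab_marginal p \<tau> S A Y)"
    unfolding x_def by (rule nn_integral_spike_slab_likelihood) fact+
  also have "ennreal (w k) * \<dots> = (\<Sum>S\<in>Pow {1..p}. ennreal (w k * nu p k S) * slab_marginal p \<tau> S A Y)"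
    using beta_weight_nonneg[OF k] by (simp add: sum_distrib_left w_def ennreal_mult' mult.assoc)
  also have "\<dots> \<le> (\<Sum>S\<in>Pow {1..p}. ennreal (eff_weight p w S) * slab_marginal p \<tau> S A Y)"
    unfolding w_def by (intro sum_mono mult_right_mono ennreal_leI weight_nu_le_eff_weight assms k) simp
  finally show ?thesis unfolding E_def k_def .
qed

subsection \<open>Contraction\<close>

lemma likelihood_measurable_pair_Gamma[measurable]:
  "(\<lambda>(Y, \<theta>). likelihood p \<theta> Y) \<in> borel_measurable (PiM {1..p} (\<lambda>_. borel) \<Otimes>\<^sub>M Gamma_prior p \<tau> S)"
proof -
  have "(\<lambda>(Y, \<theta>). likelihood p \<theta> Y) \<in> borel_measurable (PiM {1..p} (\<lambda>_. borel) \<Otimes>\<^sub>M PiM {1..p} (\<lambda>_. borel))"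
    unfolding likelihood_def normal_density_def by measurable
  then show ?thesis
    by (subst measurable_cong_sets[OF sets_pair_measure_cong[OF refl sets_Gamma_prior] refl])
qed

lemma slab_marginal_measurable[measurable]:
  assumes "\<tau> > 0" and [measurable]: "A \<in> sets (PiM {1..p} (\<lambda>_. borel))"
  shows "slab_marginal p \<tau> S A \<in> borel_measurable (PiM {1..p} (\<lambda>_. borel))"
proof -
  interpret prob_space "Gamma_prior p \<tau> S" by (rule prob_space_Gamma_prior) fact
  show ?thesis unfolding slab_marginal_def[abs_def] by measurable
qed

text \<open>Dividing by the likelihood at \<open>t\<close> turns the expectation under
  \<open>gauss p t\<close> into a Lebesgue integral; exchanging the order gives expectations under
  \<open>gauss p \<theta>\<close>. With \<open>\<psi>\<close> one minus the test, these are its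
  errors of the second kind.\<close>

lemma nn_integral_slab_marginal:
  assumes \<tau>: "\<tau> > 0" and A[measurable]: "A \<in> sets (PiM {1..p} (\<lambda>_. borel))"
    and [measurable]: "\<psi> \<in> borel_measurable (PiM {1..p} (\<lambda>_. borel))"
  shows "(\<integral>\<^sup>+Y. \<psi> Y * (slab_marginal p \<tau> S A Y * ennreal (1 / likelihood p t Y)) \<partial>gauss p t) =
    (\<integral>\<^sup>+\<theta>. indicator A \<theta> * (\<integral>\<^sup>+Y. \<psi> Y \<partial>gauss p \<theta>) \<partial>Gamma_prior p \<tau> S)"
proof -
  let ?L = "PiM {1..p} (\<lambda>_. lborel :: real measure)"
  let ?G = "Gamma_prior p \<tau> S"
  interpret G: prob_space ?G by (rule prob_space_Gamma_prior) fact
  interpret product_sigma_finite "\<lambda>_::nat. lborel :: real measure" ..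
  interpret L: sigma_finite_measure ?L by (rule sigma_finite) simp
  interpret GL: pair_sigma_finite ?G ?L ..
  note [measurable] = slab_marginal_measurable[OF \<tau> A]
  have cancel: "ennreal (likelihood p t Y) * (a * (b * ennreal (1 / likelihood p t Y))) = a * b" for Y a b
  proof -
    have "ennreal (likelihood p t Y) * ennreal (1 / likelihood p t Y) = 1"
      using likelihood_pos[of p t Y] by (subst ennreal_mult'[symmetric]) auto
    then show ?thesis by (metis mult.assoc mult.commute mult_1_right)
  qed
  have "(\<lambda>(\<theta>, Y). \<psi> Y * (ennreal (likelihood p \<theta> Y) * indicator A \<theta>)) \<in>
      borel_measurable (PiM {1..p} (\<lambda>_. borel) \<Otimes>\<^sub>M PiM {1..p} (\<lambda>_. borel))"
    using likelihood_measurable_pair[of p] by measurable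
  then have meas: "(\<lambda>(\<theta>, Y). \<psi> Y * (ennreal (likelihood p \<theta> Y) * indicator A \<theta>)) \<in> borel_measurable (?G \<Otimes>\<^sub>M ?L)"
    by (subst measurable_cong_sets[OF sets_pair_measure_cong[OF sets_Gamma_prior sets_PiM_lborel] refl])
  have "(\<integral>\<^sup>+Y. \<psi> Y * (slab_marginal p \<tau> S A Y * ennreal (1 / likelihood p t Y)) \<partial>gauss p t) =
      (\<integral>\<^sup>+Y. \<psi> Y * slab_marginal p \<tau> S A Y \<partial>?L)"
    by (subst nn_integral_gauss) (measurable, simp only: cancel)
  also have "\<dots> = (\<integral>\<^sup>+Y. \<integral>\<^sup>+\<theta>. \<psi> Y * (ennreal (likelihood p \<theta> Y) * indicator A \<theta>) \<partial>?G \<partial>?L)"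
    unfolding slab_marginal_def by (intro nn_integral_cong nn_integral_cmult[symmetric]) measurable
  also have "\<dots> = (\<integral>\<^sup>+\<theta>. \<integral>\<^sup>+Y. \<psi> Y * (ennreal (likelihood p \<theta> Y) * indicator A \<theta>) \<partial>?L \<partial>?G)"
    by (rule GL.Fubini') (rule meas)
  also have "\<dots> = (\<integral>\<^sup>+\<theta>. indicator A \<theta> * (\<integral>\<^sup>+Y. \<psi> Y \<partial>gauss p \<theta>) \<partial>?G)"
  proof (intro nn_integral_cong)
    fix \<theta>
    have "(\<lambda>Y. ennreal (likelihood p \<theta> Y) * \<psi> Y) \<in> borel_measurable ?L"
      unfolding measurable_cong_sets[OF sets_PiM_lborel refl] by measurable
    then have "indicator A \<theta> * (\<integral>\<^sup>+Y. ennreal (likelihood p \<theta> Y) * \<psi> Y \<partial>?L) =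
        (\<integral>\<^sup>+Y. indicator A \<theta> * (ennreal (likelihood p \<theta> Y) * \<psi> Y) \<partial>?L)"
      by (rule nn_integral_cmult[symmetric])
    then show "(\<integral>\<^sup>+Y. \<psi> Y * (ennreal (likelihood p \<theta> Y) * indicator A \<theta>) \<partial>?L) =
        indicator A \<theta> * (\<integral>\<^sup>+Y. \<psi> Y \<partial>gauss p \<theta>)"
      by (simp add: nn_integral_gauss mult_ac)
  qed
  finally show ?thesis .
qed

text \<open>The likelihood ratio is inverted: its mean under \<open>gauss p t\<close> is then the
  exponential of the divergence, which is bounded on the ball, and a small value of the integral
  forces a large evidence.\<close>

definition inv_ratio :: "nat \<Rightarrow> real \<Rightarrow> nat set \<Rightarrow> (nat \<Rightarrow> real) set \<Rightarrow> (nat \<Rightarrow> real) \<Rightarrow> (nat \<Rightarrow> real) \<Rightarrow> ennreal" where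
  "inv_ratio p \<tau> T B t Y = (\<integral>\<^sup>+\<theta>. ennreal (likelihood p t Y / likelihood p \<theta> Y) * indicator B \<theta> \<partial>Gamma_prior p \<tau> T)"

lemma inv_ratio_measurable:
  assumes "\<tau> > 0" and [measurable]: "B \<in> sets (PiM {1..p} (\<lambda>_. borel))"
  shows "inv_ratio p \<tau> T B t \<in> borel_measurable (PiM {1..p} (\<lambda>_. borel))"
proof -
  interpret prob_space "Gamma_prior p \<tau> T" by (rule prob_space_Gamma_prior) fact
  show ?thesis unfolding inv_ratio_def[abs_def] by measurable
qed

lemma nn_integral_inv_ratio_theta_ball:
  assumes "\<tau> > 0"
  shows "(\<integral>\<^sup>+Y. inv_ratio p \<tau> T (theta_ball p t T r) t Y \<partial>gauss p t) \<le>
    ennreal (exp (2 * r) * measure (Gamma_prior p \<tau> T) (theta_ball p t T r))"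
proof -
  let ?G = "Gamma_prior p \<tau> T" and ?B = "theta_ball p t T r"
  interpret G: prob_space ?G by (rule prob_space_Gamma_prior) fact
  interpret P: prob_space "gauss p t" by (rule prob_space_gauss)
  interpret GP: pair_sigma_finite ?G "gauss p t" ..
  have "(\<lambda>(\<theta>, Y). ennreal (likelihood p t Y / likelihood p \<theta> Y) * indicator ?B \<theta>) \<in>
      borel_measurable (PiM {1..p} (\<lambda>_. borel) \<Otimes>\<^sub>M PiM {1..p} (\<lambda>_. borel))"
    using likelihood_measurable_pair[of p] by measurable
  then have meas: "(\<lambda>(\<theta>, Y). ennreal (likelihood p t Y / likelihood p \<theta> Y) * indicator ?B \<theta>) \<in> borel_measurable (?G \<Otimes>\<^sub>M gauss p t)"
    by (subst measurable_cong_sets[OF sets_pair_measure_cong[OF sets_Gamma_prior sets_gauss] refl])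
  have "(\<integral>\<^sup>+Y. inv_ratio p \<tau> T ?B t Y \<partial>gauss p t) =
      (\<integral>\<^sup>+\<theta>. \<integral>\<^sup>+Y. ennreal (likelihood p t Y / likelihood p \<theta> Y) * indicator ?B \<theta> \<partial>gauss p t \<partial>?G)"
    unfolding inv_ratio_def by (rule GP.Fubini') (rule meas)
  also have "\<dots> = (\<integral>\<^sup>+\<theta>. ennreal (exp (sq_dist p \<theta> t)) * indicator ?B \<theta> \<partial>?G)"
    by (intro nn_integral_cong) (subst nn_integral_multc, simp_all add: nn_integral_likelihood_ratio)
  also have "\<dots> \<le> (\<integral>\<^sup>+\<theta>. ennreal (exp (2 * r)) * indicator ?B \<theta> \<partial>?G)"
    by (intro nn_integral_mono) (auto simp: theta_ball_def indicator_def intro!: ennreal_leI)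
  also have "\<dots> = ennreal (exp (2 * r) * measure ?G ?B)"
    by (simp add: nn_integral_cmult_indicator G.emeasure_eq_measure ennreal_mult')
  finally show ?thesis .
qed

text \<open>Integrating \<open>2 \<le> v + 1 / v\<close> over \<open>B\<close> replaces Jensen's inequality.\<close>

lemma slab_marginal_ge:
  assumes "\<tau> > 0" and B[measurable]: "B \<in> sets (PiM {1..p} (\<lambda>_. borel))"
    and H: "inv_ratio p \<tau> T B t Y \<le> ennreal (exp c * measure (Gamma_prior p \<tau> T) B)"
  shows "ennreal (exp (- c) * measure (Gamma_prior p \<tau> T) B * likelihood p t Y) \<le> slab_marginal p \<tau> T B Y"
proof -
  let ?G = "Gamma_prior p \<tau> T"
  interpret G: prob_space ?G by (rule prob_space_Gamma_prior) fact
  define g where "g = measure ?G B"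
  have g: "g \<ge> 0" "emeasure ?G B = ennreal g" by (simp_all add: g_def G.emeasure_eq_measure)
  define L where "L = likelihood p t Y"
  have L: "L > 0" by (simp add: L_def likelihood_pos)
  \<comment> \<open>\<open>v\<close> is the likelihood ratio scaled by \<open>exp c\<close>; with
    this scale \<open>H\<close> bounds the integral of \<open>1 / v\<close> by the mass of
    \<open>B\<close>, so at least as much is left for \<open>v\<close>.\<close>
  have pw: "2 \<le> exp c / L * likelihood p \<theta> Y + exp (- c) * (L / likelihood p \<theta> Y)" for \<theta>
  proof -
    define v where "v = exp c / L * likelihood p \<theta> Y"
    have v: "v > 0" using L likelihood_pos[of p \<theta> Y] by (simp add: v_def)
    have "exp (- c) * (L / likelihood p \<theta> Y) = 1 / v"
      by (simp add: v_def exp_minus field_simps)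
    moreover have "2 \<le> v + 1 / v"
      using v zero_le_power2[of "v - 1"] by (simp add: field_simps power2_eq_square)
    ultimately show ?thesis by (simp add: v_def)
  qed
  have "ennreal (2 * g) = (\<integral>\<^sup>+\<theta>. ennreal 2 * indicator B \<theta> \<partial>?G)"
    by (subst nn_integral_cmult_indicator) (simp_all add: g ennreal_mult')
  also have "\<dots> \<le> (\<integral>\<^sup>+\<theta>. ennreal (exp c / L) * (ennreal (likelihood p \<theta> Y) * indicator B \<theta>)
      + ennreal (exp (- c)) * (ennreal (L / likelihood p \<theta> Y) * indicator B \<theta>) \<partial>?G)"
  proof (intro nn_integral_mono)
    fix \<theta>
    have "ennreal 2 \<le> ennreal (exp c / L) * ennreal (likelihood p \<theta> Y) + ennreal (exp (- c)) * ennreal (L / likelihood p \<theta> Y)"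
      using pw[of \<theta>] L likelihood_pos[of p \<theta> Y]
      by (simp only: ennreal_mult'[symmetric] ennreal_plus[symmetric] ennreal_leI exp_ge_zero
          less_imp_le divide_nonneg_pos mult_nonneg_nonneg)
    then show "ennreal 2 * indicator B \<theta> \<le> ennreal (exp c / L) * (ennreal (likelihood p \<theta> Y) * indicator B \<theta>)
      + ennreal (exp (- c)) * (ennreal (L / likelihood p \<theta> Y) * indicator B \<theta>)"
      by (auto simp: indicator_def)
  qed
  also have "\<dots> = ennreal (exp c / L) * slab_marginal p \<tau> T B Y + ennreal (exp (- c)) * inv_ratio p \<tau> T B t Y"
    unfolding slab_marginal_def inv_ratio_def L_def[symmetric]
    by (subst nn_integral_add, measurable) (subst (1 2) nn_integral_cmult, measurable)
  also have "\<dots> \<le> ennreal (exp c / L) * slab_marginal p \<tau> T B Y + ennreal (exp (- c)) * ennreal (exp c * g)"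
    using H by (intro add_left_mono mult_left_mono) (auto simp: g_def)
  also have "ennreal (exp (- c)) * ennreal (exp c * g) = ennreal g"
    by (subst ennreal_mult'[symmetric]) (simp_all add: mult.assoc[symmetric] flip: exp_add)
  finally have *: "ennreal (2 * g) \<le> ennreal (exp c / L) * slab_marginal p \<tau> T B Y + ennreal g" .
  obtain m where m: "slab_marginal p \<tau> T B Y = ennreal m" "m \<ge> 0"
    using slab_marginal_le_1[OF assms(1), of p T B Y] by (cases "slab_marginal p \<tau> T B Y") (auto simp: top_unique)
  have "2 * g \<le> exp c / L * m + g"
    using * g m L by (simp only: m ennreal_mult'[symmetric] exp_ge_zero less_imp_le divide_nonneg_pos
      ennreal_plus[symmetric] mult_nonneg_nonneg ennreal_le_iff add_nonneg_nonneg)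
  then have "g \<le> exp c / L * m" by simp
  then have "g * (exp (- c) * L) \<le> (exp c / L * m) * (exp (- c) * L)"
    using L by (intro mult_right_mono) auto
  also have "\<dots> = m" using L by (simp add: exp_minus)
  finally show ?thesis unfolding m(1) g_def[symmetric] L_def[symmetric] by (intro ennreal_leI) (simp add: mult_ac)
qed

lemma far_sets[measurable]: "{\<theta> \<in> vecs p. sq_dist p \<theta> t > c} \<in> sets (PiM {1..p} (\<lambda>_. borel))"
proof -
  have "{\<theta> \<in> vecs p. sq_dist p \<theta> t > c} = vecs p \<inter> {\<theta> \<in> space (PiM {1..p} (\<lambda>_. borel)). sq_dist p \<theta> t > c}"
    by (auto simp: vecs_def space_PiM)
  also have "\<dots> \<in> sets (PiM {1..p} (\<lambda>_. borel))" by measurable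
  finally show ?thesis .
qed

lemma slab_mass_far_le:
  fixes M :: real
  assumes \<tau>: "\<tau> > 0" and p: "p \<ge> 2" and S: "S \<subseteq> {1..p}" and T: "T \<subseteq> {1..p}" and t: "t \<in> Theta p T"
  defines "r \<equiv> real (card T) * ln (real p)"
  defines "A \<equiv> {\<theta> \<in> vecs p. sq_dist p \<theta> t > M * r}"
  shows "(\<integral>\<^sup>+\<theta>. indicator A \<theta> * (\<integral>\<^sup>+Y. ennreal (1 - sparse_test p r t Y) \<partial>gauss p \<theta>) \<partial>Gamma_prior p \<tau> S) \<le>
    ennreal (exp (complexity_const \<tau> * (real (card S) * ln (real p) + r) - 5 / 48 * M * r)
      * measure (Gamma_prior p \<tau> T) (theta_ball p t T r))"
proof -
  let ?s = "real (card S) * ln (real p)"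
  \<comment> \<open>The rate 1/6 of the test error splits as 5/48 + 1/16: on \<open>A\<close> the
    first part is bounded through the distance exceeding \<open>M * r\<close>, the second is kept as
    the bump.\<close>
  let ?k = "exp (3 * ?s + 6 * r - 5 / 48 * M * r)"
  let ?D = "measure (Gamma_prior p \<tau> T) (theta_ball p t T r)"
  have ln: "ln (real p) \<ge> 0" using p by simp
  have "(\<integral>\<^sup>+\<theta>. indicator A \<theta> * (\<integral>\<^sup>+Y. ennreal (1 - sparse_test p r t Y) \<partial>gauss p \<theta>) \<partial>Gamma_prior p \<tau> S) \<le>
      (\<integral>\<^sup>+\<theta>. ennreal ?k * ennreal (exp (- sq_dist p \<theta> t / 16)) \<partial>Gamma_prior p \<tau> S)"
  proof (rule nn_integral_mono_AE)
    show "AE \<theta> in Gamma_prior p \<tau> S. indicator A \<theta> * (\<integral>\<^sup>+Y. ennreal (1 - sparse_test p r t Y) \<partial>gauss p \<theta>) \<le>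
        ennreal ?k * ennreal (exp (- sq_dist p \<theta> t / 16))"
      using AE_Gamma_prior_Theta[OF \<tau>, of p S]
    proof eventually_elim
      case (elim \<theta>)
      show ?case
      proof (cases "\<theta> \<in> A")
        case True
        have "(\<integral>\<^sup>+Y. ennreal (1 - sparse_test p r t Y) \<partial>gauss p \<theta>) \<le>
            ennreal (exp (3 * real (card S) * ln (real p) + 6 * r - sq_dist p \<theta> t / 6))"
          unfolding r_def by (rule nn_integral_one_minus_sparse_test_le) fact+
        also have "\<dots> \<le> ennreal (?k * exp (- sq_dist p \<theta> t / 16))"
          unfolding exp_add[symmetric] using True by (intro ennreal_leI) (simp add: A_def)
        finally show ?thesis using True by (simp add: ennreal_mult')
      qed simp
    qed
  qed
  also have "\<dots> = ennreal ?k * (\<integral>\<^sup>+\<theta>. ennreal (exp (- sq_dist p \<theta> t / 16)) \<partial>Gamma_prior p \<tau> S)"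
    by (rule nn_integral_cmult) measurable
  also have "\<dots> \<le> ennreal ?k * ennreal (exp ((complexity_const \<tau> - 6) * (?s + r)) * ?D)"
    unfolding r_def by (intro mult_left_mono bump_ratio(1) assms) simp
  also have "\<dots> = ennreal (?k * exp ((complexity_const \<tau> - 6) * (?s + r)) * ?D)"
    by (subst ennreal_mult'[symmetric]) (simp_all add: mult_ac)
  also have "\<dots> \<le> ennreal (exp (complexity_const \<tau> * (?s + r) - 5 / 48 * M * r) * ?D)"
  proof (intro ennreal_leI mult_right_mono)
    have "0 \<le> ?s" using ln by simp
    then show "?k * exp ((complexity_const \<tau> - 6) * (?s + r)) \<le> exp (complexity_const \<tau> * (?s + r) - 5 / 48 * M * r)"
      unfolding exp_add[symmetric] by (simp add: algebra_simps)
  qed simp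
  finally show ?thesis .
qed

text \<open>The three terms are the level of the test, the chance of a small denominator, and the
  sum over \<open>S\<close>. In the last, 3 comes from the denominator,
  \<open>complexity_const\<close> from test and prior and \<open>C4\<close> from the weights; the 4
  required of \<open>M\<close> leaves one further \<open>r\<close>.\<close>

lemma posterior_contraction:
  assumes \<tau>: "\<tau> > 0" and p: "p \<ge> 2" and T: "T \<subseteq> {1..p}" and t: "t \<in> Theta p T"
    and \<alpha>\<beta>: "\<alpha> \<ge> 1" "\<beta> \<ge> 1" and l: "l \<in> {0..1}"
  defines "r \<equiv> real (card T) * ln (real p)" and "w \<equiv> beta_weight \<alpha> \<beta>"
  assumes W: "w l * nu p l T > 0"
    and sum: "(\<Sum>S\<in>Pow {1..p}. eff_weight p w S / (w l * nu p l T)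
      * exp (2 * complexity_const \<tau> * real (card S) * ln (real p))) \<le> exp (C4 * r)"
    and M: "5 / 48 * M \<ge> 4 + complexity_const \<tau> + C4"
  shows "(\<integral>\<^sup>+Y. emeasure (posterior p \<tau> (lam_hat p \<tau> w Y) Y) {\<theta> \<in> vecs p. sq_dist p \<theta> t > M * r} \<partial>gauss p t)
    \<le> ennreal (3 * exp (- r))"
proof -
  define A where "A = {\<theta> \<in> vecs p. sq_dist p \<theta> t > M * r}"
  have A[measurable]: "A \<in> sets (PiM {1..p} (\<lambda>_. borel))" unfolding A_def by measurable
  define B where "B = theta_ball p t T r"
  have B[measurable]: "B \<in> sets (PiM {1..p} (\<lambda>_. borel))" unfolding B_def by measurable
  define D where "D = measure (Gamma_prior p \<tau> T) B"
  have D: "D > 0" unfolding D_def B_def r_def using assms by (intro bump_ratio(2)[of _ _ T]) auto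
  define V where "V = w l * nu p l T"
  have V: "V > 0" using W by (simp add: V_def)
  define H where "H = inv_ratio p \<tau> T B t"
  have [measurable]: "H \<in> borel_measurable (PiM {1..p} (\<lambda>_. borel))"
    unfolding H_def by (rule inv_ratio_measurable) fact+
  note [measurable] = slab_marginal_measurable[OF \<tau> A]
  define Q where "Q S Y = ennreal (1 - sparse_test p r t Y) * (slab_marginal p \<tau> S A Y * ennreal (1 / likelihood p t Y))" for S Y
  have Q[measurable]: "Q S \<in> borel_measurable (PiM {1..p} (\<lambda>_. borel))" for S
    unfolding Q_def[abs_def] by measurable
  \<comment> \<open>The reciprocal of the lower bound for the denominator, up to the likelihood at
    \<open>t\<close>.\<close>
  define k where "k = exp (3 * r) / (V * D)"
  have k: "k > 0" using V D by (simp add: k_def)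
  have eff: "eff_weight p w S \<ge> 0" for S
    using weight_nu_le_eff_weight[OF \<alpha>\<beta> l, of p S] beta_weight_nonneg[OF l, of \<alpha> \<beta>] nu_nonneg[OF l, of p S]
    unfolding w_def by (meson mult_nonneg_nonneg order_trans)
  have mid: "b \<le> a + b + c" and skip: "a + c \<le> a + b + c" for a b c :: ennreal
    using add_left_mono[of 0 "a + c" b] add_left_mono[of 0 b "a + c"] by (simp_all add: add_ac)
  have pw: "emeasure (posterior p \<tau> (lam_hat p \<tau> w Y) Y) A \<le>
      ennreal (sparse_test p r t Y) + ennreal (exp (- 3 * r) / D) * H Y
      + (\<Sum>S\<in>Pow {1..p}. ennreal (k * eff_weight p w S) * Q S Y)" for Y
  proof (cases "H Y \<le> ennreal (exp (3 * r) * D)")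
    case False
    \<comment> \<open>Markov's inequality in pointwise form. The mean of \<open>H\<close> is at most
      \<open>exp (2 * r) * D\<close>, so the threshold \<open>exp (3 * r) * D\<close> leaves
      \<open>exp (- r)\<close>.\<close>
    have "1 = ennreal (exp (- 3 * r) / D) * ennreal (exp (3 * r) * D)"
      using D by (subst ennreal_mult'[symmetric]) (simp_all add: exp_minus)
    also have "\<dots> \<le> ennreal (exp (- 3 * r) / D) * H Y" using False by (intro mult_left_mono) auto
    finally have "emeasure (posterior p \<tau> (lam_hat p \<tau> w Y) Y) A \<le> ennreal (exp (- 3 * r) / D) * H Y"
      using emeasure_posterior(2)[OF A] order_trans by blast
    then show ?thesis using mid by (rule order_trans)
  next
    case True
    define E where "E = emeasure (posterior p \<tau> (lam_hat p \<tau> w Y) Y) A"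
    let ?L = "likelihood p t Y"
    have L: "?L > 0" by (rule likelihood_pos)
    have "ennreal (exp (- (3 * r)) * D * ?L) \<le> slab_marginal p \<tau> T B Y"
      using True unfolding D_def H_def by (intro slab_marginal_ge) (use \<tau> B in auto)
    then have "E * (ennreal V * ennreal (exp (- (3 * r)) * D * ?L)) \<le> E * (ennreal V * slab_marginal p \<tau> T B Y)"
      by (intro mult_left_mono) auto
    also have "\<dots> \<le> (\<Sum>S\<in>Pow {1..p}. ennreal (eff_weight p w S) * slab_marginal p \<tau> S A Y)"
      unfolding E_def V_def w_def by (rule posterior_lam_hat_le) fact+
    also have "ennreal V * ennreal (exp (- (3 * r)) * D * ?L) = ennreal (?L / k)"
      using V D by (subst ennreal_mult'[symmetric]) (simp_all add: k_def exp_minus field_simps)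
    finally have *: "E * ennreal (?L / k) \<le> (\<Sum>S\<in>Pow {1..p}. ennreal (eff_weight p w S) * slab_marginal p \<tau> S A Y)" .
    have one: "ennreal (?L / k) * (ennreal k * ennreal (1 / ?L)) = 1"
      using k L by (simp only: ennreal_mult'[symmetric] less_imp_le divide_pos_pos zero_less_one) simp
    have "E = E * ennreal (?L / k) * (ennreal k * ennreal (1 / ?L))"
      by (simp only: mult.assoc one mult_1_right)
    also have "\<dots> \<le> (\<Sum>S\<in>Pow {1..p}. ennreal (eff_weight p w S) * slab_marginal p \<tau> S A Y) * (ennreal k * ennreal (1 / ?L))"
      using * by (rule mult_right_mono) simp
    also have "\<dots> = (\<Sum>S\<in>Pow {1..p}. ennreal (k * eff_weight p w S) * (slab_marginal p \<tau> S A Y * ennreal (1 / ?L)))"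
      unfolding sum_distrib_right using k by (intro sum.cong) (simp_all add: ennreal_mult' mult_ac)
    finally have E: "E \<le> (\<Sum>S\<in>Pow {1..p}. ennreal (k * eff_weight p w S) * (slab_marginal p \<tau> S A Y * ennreal (1 / ?L)))" .
    \<comment> \<open>The trivial bound 1 is spent on the part with the test, the sum over
      \<open>S\<close> on the part with its complement.\<close>
    have "E = (ennreal (sparse_test p r t Y) + ennreal (1 - sparse_test p r t Y)) * E"
      using sparse_test_bounds[of p r t Y] by (subst ennreal_plus[symmetric]) auto
    also have "\<dots> = ennreal (sparse_test p r t Y) * E + ennreal (1 - sparse_test p r t Y) * E"
      by (rule distrib_right)
    also have "\<dots> \<le> ennreal (sparse_test p r t Y) * 1 + ennreal (1 - sparse_test p r t Y) *
        (\<Sum>S\<in>Pow {1..p}. ennreal (k * eff_weight p w S) * (slab_marginal p \<tau> S A Y * ennreal (1 / ?L)))"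
      using E emeasure_posterior(2)[OF A] unfolding E_def by (intro add_mono mult_left_mono) auto
    also have "\<dots> = ennreal (sparse_test p r t Y) + (\<Sum>S\<in>Pow {1..p}. ennreal (k * eff_weight p w S) * Q S Y)"
      by (simp add: sum_distrib_left Q_def mult_ac)
    finally show ?thesis unfolding E_def using skip by (rule order_trans)
  qed
  have "(\<integral>\<^sup>+Y. emeasure (posterior p \<tau> (lam_hat p \<tau> w Y) Y) A \<partial>gauss p t) \<le>
      (\<integral>\<^sup>+Y. ennreal (sparse_test p r t Y) + ennreal (exp (- 3 * r) / D) * H Y
      + (\<Sum>S\<in>Pow {1..p}. ennreal (k * eff_weight p w S) * Q S Y) \<partial>gauss p t)"
    \<comment> \<open>The majorant is measurable and holds for every \<open>Y\<close>; measurability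
      of the left side, which contains the arg max, is not at issue here.\<close>
    by (rule nn_integral_mono) (rule pw)
  also have "\<dots> = (\<integral>\<^sup>+Y. ennreal (sparse_test p r t Y) \<partial>gauss p t)
      + ennreal (exp (- 3 * r) / D) * (\<integral>\<^sup>+Y. H Y \<partial>gauss p t)
      + (\<Sum>S\<in>Pow {1..p}. ennreal (k * eff_weight p w S) * (\<integral>\<^sup>+Y. Q S Y \<partial>gauss p t))"
    by (simp add: nn_integral_add nn_integral_sum nn_integral_cmult)
  also have "\<dots> \<le> ennreal (exp (- r)) + ennreal (exp (- r)) + ennreal (exp (- r))"
  proof (intro add_mono)
    have "(\<integral>\<^sup>+Y. ennreal (sparse_test p r t Y) \<partial>gauss p t) = ennreal (\<integral>Y. sparse_test p r t Y \<partial>gauss p t)"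
      by (rule nn_integral_unit_gauss) (auto simp: sparse_test_bounds)
    also have "\<dots> \<le> ennreal (exp (- r))"
      unfolding r_def by (intro ennreal_leI integral_sparse_test_le p)
    finally show "(\<integral>\<^sup>+Y. ennreal (sparse_test p r t Y) \<partial>gauss p t) \<le> ennreal (exp (- r))" .
    have "ennreal (exp (- 3 * r) / D) * (\<integral>\<^sup>+Y. H Y \<partial>gauss p t) \<le> ennreal (exp (- 3 * r) / D) * ennreal (exp (2 * r) * D)"
      unfolding H_def D_def B_def by (intro mult_left_mono nn_integral_inv_ratio_theta_ball \<tau>) simp
    also have "\<dots> = ennreal (exp (- 3 * r) / D * (exp (2 * r) * D))"
      using D by (intro ennreal_mult'[symmetric]) simp
    also have "exp (- 3 * r) / D * (exp (2 * r) * D) = exp (- r)"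
      using D by (simp flip: exp_add)
    finally show "ennreal (exp (- 3 * r) / D) * (\<integral>\<^sup>+Y. H Y \<partial>gauss p t) \<le> ennreal (exp (- r))" .
    have "(\<Sum>S\<in>Pow {1..p}. ennreal (k * eff_weight p w S) * (\<integral>\<^sup>+Y. Q S Y \<partial>gauss p t)) \<le>
        (\<Sum>S\<in>Pow {1..p}. ennreal (exp ((3 + complexity_const \<tau> - 5 / 48 * M) * r) *
          (eff_weight p w S / V * exp (2 * complexity_const \<tau> * real (card S) * ln (real p)))))"
    proof (rule sum_mono)
      fix S assume "S \<in> Pow {1..p}"
      then have S: "S \<subseteq> {1..p}" by simp
      let ?s = "real (card S) * ln (real p)"
      have "(\<integral>\<^sup>+Y. Q S Y \<partial>gauss p t) =
          (\<integral>\<^sup>+\<theta>. indicator A \<theta> * (\<integral>\<^sup>+Y. ennreal (1 - sparse_test p r t Y) \<partial>gauss p \<theta>) \<partial>Gamma_prior p \<tau> S)"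
        unfolding Q_def by (rule nn_integral_slab_marginal) (use \<tau> A in measurable)
      also have "\<dots> \<le> ennreal (exp (complexity_const \<tau> * (?s + r) - 5 / 48 * M * r) * D)"
        unfolding A_def r_def D_def B_def by (rule slab_mass_far_le) fact+
      finally have "ennreal (k * eff_weight p w S) * (\<integral>\<^sup>+Y. Q S Y \<partial>gauss p t) \<le>
          ennreal (k * eff_weight p w S) * ennreal (exp (complexity_const \<tau> * (?s + r) - 5 / 48 * M * r) * D)"
        by (rule mult_left_mono) simp
      also have "\<dots> = ennreal (k * eff_weight p w S * (exp (complexity_const \<tau> * (?s + r) - 5 / 48 * M * r) * D))"
        using k eff by (intro ennreal_mult'[symmetric]) simp
      \<comment> \<open>\<open>D\<close> cancels: the ball that bounds the denominator is the one
        against which the far mass was measured.\<close>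
      also have "k * eff_weight p w S * (exp (complexity_const \<tau> * (?s + r) - 5 / 48 * M * r) * D) =
          eff_weight p w S / V * (exp (3 * r) * exp (complexity_const \<tau> * (?s + r) - 5 / 48 * M * r))"
        using D by (simp add: k_def)
      also have "exp (3 * r) * exp (complexity_const \<tau> * (?s + r) - 5 / 48 * M * r) =
          exp ((3 + complexity_const \<tau> - 5 / 48 * M) * r) * exp (complexity_const \<tau> * ?s)"
        unfolding exp_add[symmetric] by (simp add: algebra_simps)
      also have "ennreal (eff_weight p w S / V * (exp ((3 + complexity_const \<tau> - 5 / 48 * M) * r) * exp (complexity_const \<tau> * ?s))) \<le>
          ennreal (eff_weight p w S / V * (exp ((3 + complexity_const \<tau> - 5 / 48 * M) * r) * exp (2 * complexity_const \<tau> * real (card S) * ln (real p))))"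
      proof (intro ennreal_leI mult_left_mono)
        have "complexity_const \<tau> \<ge> 0"
          using slab_upper_const_nonneg[OF \<tau>] slab_lower_const_nonneg[OF \<tau>] by (simp add: complexity_const_def)
        moreover have "?s \<ge> 0" using p by simp
        ultimately have "complexity_const \<tau> * ?s \<ge> 0" by simp
        then show "exp (complexity_const \<tau> * ?s) \<le> exp (2 * complexity_const \<tau> * real (card S) * ln (real p))"
          by (simp add: mult_ac)
      qed (use eff V in auto)
      finally show "ennreal (k * eff_weight p w S) * (\<integral>\<^sup>+Y. Q S Y \<partial>gauss p t) \<le>
        ennreal (exp ((3 + complexity_const \<tau> - 5 / 48 * M) * r) *
          (eff_weight p w S / V * exp (2 * complexity_const \<tau> * real (card S) * ln (real p))))"
        by (simp only: mult_ac)
    qed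
    also have "\<dots> = ennreal (exp ((3 + complexity_const \<tau> - 5 / 48 * M) * r) *
        (\<Sum>S\<in>Pow {1..p}. eff_weight p w S / V * exp (2 * complexity_const \<tau> * real (card S) * ln (real p))))"
      unfolding sum_distrib_left using eff V by (intro sum_ennreal) simp
    also have "\<dots> \<le> ennreal (exp ((3 + complexity_const \<tau> - 5 / 48 * M) * r) * exp (C4 * r))"
      using sum unfolding V_def by (intro ennreal_leI mult_left_mono) auto
    also have "\<dots> \<le> ennreal (exp (- r))"
    proof (intro ennreal_leI)
      have "r \<ge> 0" using p by (simp add: r_def)
      then have "(3 + complexity_const \<tau> - 5 / 48 * M + C4) * r \<le> (- 1) * r"
        using M by (intro mult_right_mono) linarith+
      then show "exp ((3 + complexity_const \<tau> - 5 / 48 * M) * r) * exp (C4 * r) \<le> exp (- r)"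
        unfolding exp_add[symmetric] by (simp add: distrib_right)
    qed
    finally show "(\<Sum>S\<in>Pow {1..p}. ennreal (k * eff_weight p w S) * (\<integral>\<^sup>+Y. Q S Y \<partial>gauss p t)) \<le> ennreal (exp (- r))" .
  qed
  also have "\<dots> = ennreal (3 * exp (- r))"
    by (simp only: ennreal_plus[symmetric] exp_ge_zero add_nonneg_nonneg) simp
  finally show ?thesis unfolding A_def .
qed

text \<open>Condition (2) is asked for nonempty \<open>Sstar\<close>: for the empty set its right
  side is 1, while with a positive denominator the term of the empty set is at least 1 and the
  others are positive. For p = 1 the logarithm vanishes and, for \<open>Sstar = {1}\<close>, the
  ball in (3) shrinks to a point without slab mass; so the conditions start at p = 2. The positivity
  conjuncts exclude division by 0.\<close>

theorem theorem4p2: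
  fixes \<tau> :: real
  assumes "\<tau> > 0"
  shows "\<exists>K>0. \<forall>C1' C2'. C1' > C2' \<and> C2' \<ge> K \<longrightarrow>
    (\<exists>C C1 C2 C3 C4 C5 \<rho> M C'.
      C > 0 \<and> C1 > 0 \<and> C2 > 0 \<and> C3 > 0 \<and> C4 > 0 \<and> C5 > 0 \<and> C > 2 * C5 \<and> \<rho> > 1 \<and> M > 0 \<and> C' > 0 \<and>
      (\<forall>(p::nat) (\<alpha>::real) (\<beta>::real) (Sstar::nat set).
        p \<ge> 1 \<and> \<alpha> \<ge> 1 \<and> real p powr C1' \<ge> \<beta> / \<alpha> \<and> \<beta> / \<alpha> \<ge> real p powr C2' \<and> Sstar \<subseteq> {1..p} \<longrightarrow>
        (let w = beta_weight \<alpha> \<beta>; r = real (card Sstar) * ln (real p) in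
          (p \<ge> 2 \<longrightarrow> (\<exists>lstar\<in>{0..1}.
            (\<forall>\<theta>star\<in>Theta p Sstar.
              \<exists>\<phi>\<in>borel_measurable (PiM {1..p} (\<lambda>_. borel)). (\<forall>Y\<in>vecs p. 0 \<le> \<phi> Y \<and> \<phi> Y \<le> 1) \<and>
                (\<integral>Y. \<phi> Y \<partial>gauss p \<theta>star) \<le> exp (- C1 * r) \<and>
                (\<forall>(\<epsilon>::real) S. \<epsilon>\<^sup>2 \<ge> r \<and> S \<subseteq> {1..p} \<longrightarrow>
                  (SUP \<theta>\<in>{\<theta> \<in> Theta p S. sq_dist p \<theta> \<theta>star \<ge> \<epsilon>\<^sup>2}.
                      ennreal (\<integral>Y. 1 - \<phi> Y \<partial>gauss p \<theta>))
                    \<le> ennreal (exp (- C * \<epsilon>\<^sup>2 + C2 * (real (card S) * ln (real p) + r))))) \<and>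
            (Sstar \<noteq> {} \<longrightarrow>
              w lstar * nu p lstar Sstar > 0 \<and>
              (\<Sum>S\<in>Pow {1..p}. eff_weight p w S / (w lstar * nu p lstar Sstar)
                  * exp (2 * C2 * real (card S) * ln (real p)))
                \<le> exp (C4 * r)) \<and>
            (\<forall>\<theta>star\<in>Theta p Sstar. \<forall>(\<epsilon>::real) S. \<epsilon>\<^sup>2 \<ge> r \<and> S \<subseteq> {1..p} \<longrightarrow>
              (let N = measure (Gamma_prior p \<tau> S) {\<theta> \<in> Theta p S. sq_dist p \<theta> \<theta>star \<le> \<epsilon>\<^sup>2};
                   D = measure (Gamma_prior p \<tau> Sstar)
                         {\<theta> \<in> Theta p Sstar. renyi \<rho> (gauss p \<theta>star) (gauss p \<theta>) \<le> ereal (C3 * r)}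
               in D > 0 \<and>
                  N / D \<le> exp (C5 * \<epsilon>\<^sup>2 + C2 * (real (card S) * ln (real p) + r)))))) \<and>
          (\<forall>\<theta>star\<in>Theta p Sstar.
            (\<integral>\<^sup>+ Y. emeasure (posterior p \<tau> (lam_hat p \<tau> w Y) Y)
                      {\<theta> \<in> vecs p. sq_dist p \<theta> \<theta>star > M * r} \<partial>gauss p \<theta>star)
              \<le> ennreal (4 * exp (- C' * r))))))"
proof -
  \<comment> \<open>\<open>2 * C2 + 3\<close>, as \<open>eff_weight_sum\<close> requires; it depends
    on \<open>\<tau>\<close> alone.\<close>
  define K where "K = 2 * complexity_const \<tau> + 3"
  have c6: "complexity_const \<tau> \<ge> 6"
    using slab_upper_const_nonneg[OF assms] slab_lower_const_nonneg[OF assms] by (simp add: complexity_const_def)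
  have main: "(let w = beta_weight \<alpha> \<beta>; r = real (card Sstar) * ln (real p) in
          (p \<ge> 2 \<longrightarrow> (\<exists>lstar\<in>{0..1}.
            (\<forall>\<theta>star\<in>Theta p Sstar.
              \<exists>\<phi>\<in>borel_measurable (PiM {1..p} (\<lambda>_. borel)). (\<forall>Y\<in>vecs p. 0 \<le> \<phi> Y \<and> \<phi> Y \<le> 1) \<and>
                (\<integral>Y. \<phi> Y \<partial>gauss p \<theta>star) \<le> exp (- 1 * r) \<and>
                (\<forall>(\<epsilon>::real) S. \<epsilon>\<^sup>2 \<ge> r \<and> S \<subseteq> {1..p} \<longrightarrow>
                  (SUP \<theta>\<in>{\<theta> \<in> Theta p S. sq_dist p \<theta> \<theta>star \<ge> \<epsilon>\<^sup>2}.
                      ennreal (\<integral>Y. 1 - \<phi> Y \<partial>gauss p \<theta>))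
                    \<le> ennreal (exp (- (1 / 6) * \<epsilon>\<^sup>2 + complexity_const \<tau> * (real (card S) * ln (real p) + r))))) \<and>
            (Sstar \<noteq> {} \<longrightarrow>
              w lstar * nu p lstar Sstar > 0 \<and>
              (\<Sum>S\<in>Pow {1..p}. eff_weight p w S / (w lstar * nu p lstar Sstar)
                  * exp (2 * complexity_const \<tau> * real (card S) * ln (real p)))
                \<le> exp ((C1' + 5) * r)) \<and>
            (\<forall>\<theta>star\<in>Theta p Sstar. \<forall>(\<epsilon>::real) S. \<epsilon>\<^sup>2 \<ge> r \<and> S \<subseteq> {1..p} \<longrightarrow>
              (let N = measure (Gamma_prior p \<tau> S) {\<theta> \<in> Theta p S. sq_dist p \<theta> \<theta>star \<le> \<epsilon>\<^sup>2};
                   D = measure (Gamma_prior p \<tau> Sstar)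
                         {\<theta> \<in> Theta p Sstar. renyi 2 (gauss p \<theta>star) (gauss p \<theta>) \<le> ereal (2 * r)}
               in D > 0 \<and>
                  N / D \<le> exp (1 / 16 * \<epsilon>\<^sup>2 + complexity_const \<tau> * (real (card S) * ln (real p) + r)))))) \<and>
          (\<forall>\<theta>star\<in>Theta p Sstar.
            (\<integral>\<^sup>+ Y. emeasure (posterior p \<tau> (lam_hat p \<tau> w Y) Y)
                      {\<theta> \<in> vecs p. sq_dist p \<theta> \<theta>star > 48 / 5 * (4 + complexity_const \<tau> + (C1' + 5)) * r} \<partial>gauss p \<theta>star)
              \<le> ennreal (4 * exp (- 1 * r))))"
    if C: "C1' > C2'" "C2' \<ge> K"
      and hyp: "p \<ge> 1" "\<alpha> \<ge> 1" "real p powr C1' \<ge> \<beta> / \<alpha>" "\<beta> / \<alpha> \<ge> real p powr C2'" and T: "Sstar \<subseteq> {1..p}"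
    for C1' C2' \<alpha> \<beta> :: real and p Sstar
  proof -
    define w where "w = beta_weight \<alpha> \<beta>"
    define r where "r = real (card Sstar) * ln (real p)"
    \<comment> \<open>The witness for \<open>lstar\<close>: the shifted point of
      \<open>beta_kernel_le\<close>, the same for every \<open>Sstar\<close>.\<close>
    define m where "m = \<alpha> / (\<alpha> + \<beta> - 1 + real p)"
    have r0: "r \<ge> 0" using hyp(1) by (simp add: r_def)
    have C1: "C1' \<ge> 1" using C c6 by (simp add: K_def)
    have "1 \<le> real p powr C2'" using hyp(1) C c6 by (intro ge_one_powr_ge_zero) (auto simp: K_def)
    then have "1 \<le> \<beta> / \<alpha>" using hyp(4) by linarith
    then have \<beta>: "\<beta> \<ge> 1" using hyp(2) by (simp add: field_simps)
    have weight: "m \<in> {0..1}" "w m * nu p m Sstar > 0"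
      "(\<Sum>S\<in>Pow {1..p}. eff_weight p w S / (w m * nu p m Sstar) * exp (2 * complexity_const \<tau> * real (card S) * ln (real p)))
        \<le> exp (2 + (C1' + 1) * r)" if p: "p \<ge> 2"
    proof -
      have "C2' \<ge> 2 * complexity_const \<tau> + 3" "complexity_const \<tau> \<ge> 0" using C c6 by (auto simp: K_def)
      note * = eff_weight_sum[OF p hyp(2-4) this C1 T, folded m_def w_def r_def]
      show "m \<in> {0..1}" "w m * nu p m Sstar > 0"
        "(\<Sum>S\<in>Pow {1..p}. eff_weight p w S / (w m * nu p m Sstar) * exp (2 * complexity_const \<tau> * real (card S) * ln (real p)))
          \<le> exp (2 + (C1' + 1) * r)"
        by (rule *)+
    qed
    have cond2: "(\<Sum>S\<in>Pow {1..p}. eff_weight p w S / (w m * nu p m Sstar) * exp (2 * complexity_const \<tau> * real (card S) * ln (real p)))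
        \<le> exp ((C1' + 5) * r)" if p: "p \<ge> 2" and ne: "Sstar \<noteq> {}"
    proof -
      have "finite Sstar" using T by (rule finite_subset) simp
      then have "card Sstar \<ge> 1" using ne by (simp add: Suc_le_eq card_gt_0_iff One_nat_def)
      then have "1 * (1 / 2) \<le> r" unfolding r_def
        using half_le_ln[OF p] by (intro mult_mono) auto
      \<comment> \<open>\<open>r \<ge> 1 / 2\<close> gives \<open>2 \<le> 4 * r\<close>, which turns
        \<open>C1' + 1\<close> into \<open>C1' + 5\<close>.\<close>
      then have "2 + (C1' + 1) * r \<le> (C1' + 5) * r" by (simp add: distrib_right)
      then show ?thesis using weight(3)[OF p] by (meson exp_le_cancel_iff order_trans)
    qed
    have test: "ennreal (\<integral>Y. 1 - sparse_test p r t Y \<partial>gauss p u) \<le>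
        ennreal (exp (- (1 / 6) * \<epsilon>\<^sup>2 + complexity_const \<tau> * (real (card S) * ln (real p) + r)))"
      if p: "p \<ge> 2" and S: "S \<subseteq> {1..p}" and t: "t \<in> Theta p Sstar" and u: "u \<in> Theta p S" "sq_dist p u t \<ge> \<epsilon>\<^sup>2"
      for S t u and \<epsilon> :: real
    proof -
      have "ennreal (\<integral>Y. 1 - sparse_test p r t Y \<partial>gauss p u) = (\<integral>\<^sup>+Y. ennreal (1 - sparse_test p r t Y) \<partial>gauss p u)"
        by (rule nn_integral_unit_gauss[symmetric]) (auto simp: sparse_test_bounds)
      also have "\<dots> \<le> ennreal (exp (3 * real (card S) * ln (real p) + 6 * r - sq_dist p u t / 6))"
        unfolding r_def by (rule nn_integral_one_minus_sparse_test_le) fact+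
      also have "\<dots> \<le> ennreal (exp (- (1 / 6) * \<epsilon>\<^sup>2 + complexity_const \<tau> * (real (card S) * ln (real p) + r)))"
      proof (intro ennreal_leI)
        have s: "real (card S) * ln (real p) \<ge> 0" using p by simp
        have "6 * (real (card S) * ln (real p) + r) \<le> complexity_const \<tau> * (real (card S) * ln (real p) + r)"
          using s r0 c6 by (intro mult_right_mono) auto
        then show "exp (3 * real (card S) * ln (real p) + 6 * r - sq_dist p u t / 6) \<le>
          exp (- (1 / 6) * \<epsilon>\<^sup>2 + complexity_const \<tau> * (real (card S) * ln (real p) + r))"
          using s u(2) by simp
      qed
      finally show ?thesis .
    qed
    have renyi_ball: "{\<theta> \<in> Theta p Sstar. renyi 2 (gauss p t) (gauss p \<theta>) \<le> ereal (2 * r)} = theta_ball p t Sstar r" for t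
      by (simp add: theta_ball_def renyi_2_gauss)
    have ratio: "0 < measure (Gamma_prior p \<tau> Sstar) (theta_ball p t Sstar r)"
      "measure (Gamma_prior p \<tau> S) {\<theta> \<in> Theta p S. sq_dist p \<theta> t \<le> \<epsilon>\<^sup>2} / measure (Gamma_prior p \<tau> Sstar) (theta_ball p t Sstar r) \<le>
        exp (1 / 16 * \<epsilon>\<^sup>2 + complexity_const \<tau> * (real (card S) * ln (real p) + r))"
      if p: "p \<ge> 2" and S: "S \<subseteq> {1..p}" and t: "t \<in> Theta p Sstar" for S t and \<epsilon> :: real
    proof -
      show pos: "0 < measure (Gamma_prior p \<tau> Sstar) (theta_ball p t Sstar r)"
        unfolding r_def using assms p S T t by (rule bump_ratio(2))
      have "measure (Gamma_prior p \<tau> S) {\<theta> \<in> Theta p S. sq_dist p \<theta> t \<le> \<epsilon>\<^sup>2} / measure (Gamma_prior p \<tau> Sstar) (theta_ball p t Sstar r) \<le>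
          exp (\<epsilon>\<^sup>2 / 16 + (complexity_const \<tau> - 6) * (real (card S) * ln (real p) + r))"
        using ball_ratio[OF assms p S T t, of "\<epsilon>\<^sup>2"] pos by (simp add: r_def pos_divide_le_eq)
      also have "\<dots> \<le> exp (1 / 16 * \<epsilon>\<^sup>2 + complexity_const \<tau> * (real (card S) * ln (real p) + r))"
      proof -
        have "0 \<le> real (card S) * ln (real p)" using p by simp
        then have "(complexity_const \<tau> - 6) * (real (card S) * ln (real p) + r) \<le> complexity_const \<tau> * (real (card S) * ln (real p) + r)"
          using r0 by (intro mult_right_mono) auto
        then show ?thesis by simp
      qed
      finally show "measure (Gamma_prior p \<tau> S) {\<theta> \<in> Theta p S. sq_dist p \<theta> t \<le> \<epsilon>\<^sup>2} / measure (Gamma_prior p \<tau> Sstar) (theta_ball p t Sstar r) \<le>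
        exp (1 / 16 * \<epsilon>\<^sup>2 + complexity_const \<tau> * (real (card S) * ln (real p) + r))" .
    qed
    have post: "(\<integral>\<^sup>+ Y. emeasure (posterior p \<tau> (lam_hat p \<tau> w Y) Y)
          {\<theta> \<in> vecs p. sq_dist p \<theta> t > 48 / 5 * (4 + complexity_const \<tau> + (C1' + 5)) * r} \<partial>gauss p t)
        \<le> ennreal (4 * exp (- 1 * r))" if t: "t \<in> Theta p Sstar" for t
    proof (cases "p \<ge> 2 \<and> Sstar \<noteq> {}")
      case True
      then have p: "p \<ge> 2" and ne: "Sstar \<noteq> {}" by auto
      have "(\<integral>\<^sup>+ Y. emeasure (posterior p \<tau> (lam_hat p \<tau> w Y) Y)
          {\<theta> \<in> vecs p. sq_dist p \<theta> t > 48 / 5 * (4 + complexity_const \<tau> + (C1' + 5)) * r} \<partial>gauss p t)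
        \<le> ennreal (3 * exp (- r))"
        unfolding w_def r_def
        by (rule posterior_contraction[OF assms p T t hyp(2) \<beta> weight(1)[OF p], where ?C4.0 = "C1' + 5"])
          (use weight(2)[OF p] cond2[OF p ne] in \<open>simp_all add: w_def r_def\<close>)
      also have "\<dots> \<le> ennreal (4 * exp (- 1 * r))" by (intro ennreal_leI) simp
      finally show ?thesis .
    next
      \<comment> \<open>Here \<open>r = 0\<close>, so the right side is 4 and the posterior mass is
        at most 1.\<close>
      case False
      interpret prob_space "gauss p t" by (rule prob_space_gauss)
      have "p = 1 \<or> Sstar = {}" using False hyp(1) by auto
      then have "r = 0" by (auto simp: r_def)
      have "(\<integral>\<^sup>+ Y. emeasure (posterior p \<tau> (lam_hat p \<tau> w Y) Y)
          {\<theta> \<in> vecs p. sq_dist p \<theta> t > 48 / 5 * (4 + complexity_const \<tau> + (C1' + 5)) * r} \<partial>gauss p t) \<le> (\<integral>\<^sup>+ Y. 1 \<partial>gauss p t)"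
        by (intro nn_integral_mono emeasure_posterior(2) far_sets)
      also have "\<dots> = 1" using emeasure_space_1 by simp
      also have "\<dots> \<le> ennreal (4 * exp (- 1 * r))" using \<open>r = 0\<close> by simp
      finally show ?thesis .
    qed
    have "\<exists>lstar\<in>{0..1}.
            (\<forall>\<theta>star\<in>Theta p Sstar.
              \<exists>\<phi>\<in>borel_measurable (PiM {1..p} (\<lambda>_. borel)). (\<forall>Y\<in>vecs p. 0 \<le> \<phi> Y \<and> \<phi> Y \<le> 1) \<and>
                (\<integral>Y. \<phi> Y \<partial>gauss p \<theta>star) \<le> exp (- 1 * r) \<and>
                (\<forall>(\<epsilon>::real) S. \<epsilon>\<^sup>2 \<ge> r \<and> S \<subseteq> {1..p} \<longrightarrow>
                  (SUP \<theta>\<in>{\<theta> \<in> Theta p S. sq_dist p \<theta> \<theta>star \<ge> \<epsilon>\<^sup>2}.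
                      ennreal (\<integral>Y. 1 - \<phi> Y \<partial>gauss p \<theta>))
                    \<le> ennreal (exp (- (1 / 6) * \<epsilon>\<^sup>2 + complexity_const \<tau> * (real (card S) * ln (real p) + r))))) \<and>
            (Sstar \<noteq> {} \<longrightarrow>
              w lstar * nu p lstar Sstar > 0 \<and>
              (\<Sum>S\<in>Pow {1..p}. eff_weight p w S / (w lstar * nu p lstar Sstar)
                  * exp (2 * complexity_const \<tau> * real (card S) * ln (real p)))
                \<le> exp ((C1' + 5) * r)) \<and>
            (\<forall>\<theta>star\<in>Theta p Sstar. \<forall>(\<epsilon>::real) S. \<epsilon>\<^sup>2 \<ge> r \<and> S \<subseteq> {1..p} \<longrightarrow>
              (let N = measure (Gamma_prior p \<tau> S) {\<theta> \<in> Theta p S. sq_dist p \<theta> \<theta>star \<le> \<epsilon>\<^sup>2};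
                   D = measure (Gamma_prior p \<tau> Sstar)
                         {\<theta> \<in> Theta p Sstar. renyi 2 (gauss p \<theta>star) (gauss p \<theta>) \<le> ereal (2 * r)}
               in D > 0 \<and>
                  N / D \<le> exp (1 / 16 * \<epsilon>\<^sup>2 + complexity_const \<tau> * (real (card S) * ln (real p) + r))))"
      if p: "p \<ge> 2"
      unfolding Let_def renyi_ball
    proof (intro bexI[of _ m] conjI ballI allI impI)
      fix t assume t: "t \<in> Theta p Sstar"
      show "\<exists>\<phi>\<in>borel_measurable (PiM {1..p} (\<lambda>_. borel)). (\<forall>Y\<in>vecs p. 0 \<le> \<phi> Y \<and> \<phi> Y \<le> 1) \<and>
                (\<integral>Y. \<phi> Y \<partial>gauss p t) \<le> exp (- 1 * r) \<and>
                (\<forall>(\<epsilon>::real) S. \<epsilon>\<^sup>2 \<ge> r \<and> S \<subseteq> {1..p} \<longrightarrow>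
                  (SUP \<theta>\<in>{\<theta> \<in> Theta p S. sq_dist p \<theta> t \<ge> \<epsilon>\<^sup>2}.
                      ennreal (\<integral>Y. 1 - \<phi> Y \<partial>gauss p \<theta>))
                    \<le> ennreal (exp (- (1 / 6) * \<epsilon>\<^sup>2 + complexity_const \<tau> * (real (card S) * ln (real p) + r))))"
      \<comment> \<open>A single test serves all \<open>\<epsilon>\<close> and
        \<open>S\<close>.\<close>
      proof (intro bexI[of _ "sparse_test p r t"] conjI ballI allI impI)
        show "(\<integral>Y. sparse_test p r t Y \<partial>gauss p t) \<le> exp (- 1 * r)"
          using integral_sparse_test_le[OF p, of t "card Sstar"] by (simp add: r_def)
      next
        fix \<epsilon> :: real and S assume "\<epsilon>\<^sup>2 \<ge> r \<and> S \<subseteq> {1..p}"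
        then show "(SUP \<theta>\<in>{\<theta> \<in> Theta p S. sq_dist p \<theta> t \<ge> \<epsilon>\<^sup>2}. ennreal (\<integral>Y. 1 - sparse_test p r t Y \<partial>gauss p \<theta>))
            \<le> ennreal (exp (- (1 / 6) * \<epsilon>\<^sup>2 + complexity_const \<tau> * (real (card S) * ln (real p) + r)))"
          using p t by (intro SUP_least test) auto
      qed (use sparse_test_bounds in auto)
    qed (use weight[OF p] cond2[OF p] ratio[OF p] in auto)
    with post show ?thesis unfolding Let_def w_def r_def by blast
  qed
  have pos: "C1' > 0" if "C1' > C2' \<and> C2' \<ge> K" for C1' C2' :: real
    using that c6 by (simp add: K_def)
  show ?thesis
    apply (rule exI[of _ K], rule conjI)
    subgoal using c6 by (simp add: K_def)
    apply (intro allI impI)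
    subgoal premises C for C1' C2'
      \<comment> \<open>The witnesses for C, C1, C2, C3, C4, C5, \<open>\<rho>\<close>, M, C' in
        this order. \<open>C > 2 * C5\<close> reads 1/6 > 1/8, and \<open>M\<close> solves
        \<open>5 / 48 * M = 4 + C2 + C4\<close>.\<close>
      apply (rule exI[of _ "1 / 6"], rule exI[of _ 1], rule exI[of _ "complexity_const \<tau>"], rule exI[of _ 2],
        rule exI[of _ "C1' + 5"], rule exI[of _ "1 / 16"], rule exI[of _ 2],
        rule exI[of _ "48 / 5 * (4 + complexity_const \<tau> + (C1' + 5))"], rule exI[of _ 1])
      apply (intro conjI allI impI)
      using pos[OF C] c6 apply simp_all[10]
      subgoal premises hyp for p \<alpha> \<beta> Sstar
        by (rule main[where ?C2' = C2' and ?C1' = C1']) (use C hyp in simp_all)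
      done
    done
qed

end
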